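(* Let $N\ge 1$ and let $(a_j)_{j=1}^{\ell}$, $(b_j)_{j=1}^{\ell}$ be sequences of nonnegative integers. Let $\mu$ and $\widetilde{\mu}$ be the partitions with exactly $a_j$ and $b_j$ parts of size $j$ ($1\le j\le \ell$), respectively. If $$\min\Big\{\sum_{j=1}^{\ell} a_j,\ \sum_{j=1}^{\ell} b_j\Big\}\le N,$$ then $$\int_{U(N)} \prod_{j=1}^{\ell} \big(\mathrm{Tr}\,\mathrm{Sym}^j(U)\big)^{a_j}\, \overline{\big(\mathrm{Tr}\,\mathrm{Sym}^j(U)\big)^{b_j}}\, dU = N_{\mu,\widetilde{\mu}}.$$
   Context: $U(N)$ is the group of $N\times N$ complex unitary matrices and $dU$ is its Haar probability measure. $\mathrm{Tr}\,\mathrm{Sym}^j(U)$ is the trace of the $j$th symmetric power of $U$; equivalently, it is the $j$th complete homogeneous symmetric polynomial $h_j$ evaluated at the $N$ eigenvalues of $U$. For an $m\times n$ matrix $A=(a_{i,j})$ with nonnegative integer entries, $\mathrm{row}(A)\in\mathbb{Z}^m$ and $\mathrm{col}(A)\in\mathbb{Z}^n$ are the vectors of row sums and column sums: $\mathrm{row}(A)_i=\sum_{j} a_{i,j}$, $\mathrm{col}(A)_j=\sum_i a_{i,j}$. For partitions $\mu=(\mu_1,\ldots,\mu_m)$ and $\widetilde{\mu}=(\widetilde{\mu}_1,\ldots,\widetilde{\mu}_n)$ (not necessarily of the same integer), $N_{\mu,\widetilde{\mu}}$ is the number of $m\times n$ matrices $A$ with nonnegative integer entries such that $\mathrm{row}(A)=\mu$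 and $\mathrm{col}(A)=\widetilde{\mu}$. *)

theory Defs
  imports "HOL-Probability.Probability" "HOL-Library.Poly_Mapping"
begin

definition conj_transpose :: "complex^'n^'n \<Rightarrow> complex^'n^'n" where
  "conj_transpose U = (\<chi> i j. cnj (U $ j $ i))"

definition unitary_group :: "(complex^'n^'n) set" where
  "unitary_group = {U. conj_transpose U ** U = mat 1 \<and> U ** conj_transpose U = mat 1}"

text \<open>The group is compact, so a left-invariant Borel probability measure on it exists and is
  unique.  Borel probability measures on compact metric spaces are regular, so no regularity
  condition is imposed.\<close>

definition haar_prob_measure :: "(complex^'n^'n) measure \<Rightarrow> bool" where
  "haar_prob_measure M \<longleftrightarrow>
     prob_space M \<and>
     sets M = sets (restrict_space borel unitary_group) \<and>
     (\<forall>V\<in>unitary_group. distr M M (\<lambda>U. V ** U) = M)"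

text \<open>The symmetric algebra of $\mathbb{C}^N$ is the polynomial ring in the standard basis vectors
  $e_k$, encoded as finitely supported maps from exponents to coefficients.  The $j$th symmetric
  power has the monomials of degree $j$ as a basis, and the $j$th symmetric power of $U$ acts on it
  multiplicatively, by $e_{i_1} \cdots e_{i_j} \mapsto (U e_{i_1}) \cdots (U e_{i_j})$.\<close>

definition exponents :: "nat \<Rightarrow> ('n::finite \<Rightarrow>\<^sub>0 nat) set" where
  "exponents j = {\<alpha>. (\<Sum>i\<in>UNIV. Poly_Mapping.lookup \<alpha> i) = j}"

definition column_form :: "complex^'n^'n \<Rightarrow> 'n \<Rightarrow> (('n \<Rightarrow>\<^sub>0 nat) \<Rightarrow>\<^sub>0 complex)" where
  "column_form U i = (\<Sum>k\<in>UNIV. Poly_Mapping.single (Poly_Mapping.single k 1) (U $ k $ i))"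

definition sym_image :: "complex^'n^'n \<Rightarrow> ('n \<Rightarrow>\<^sub>0 nat) \<Rightarrow> (('n \<Rightarrow>\<^sub>0 nat) \<Rightarrow>\<^sub>0 complex)" where
  "sym_image U \<alpha> = (\<Prod>i\<in>UNIV. column_form U i ^ Poly_Mapping.lookup \<alpha> i)"

definition sym_entry :: "complex^'n^'n \<Rightarrow> ('n \<Rightarrow>\<^sub>0 nat) \<Rightarrow> ('n \<Rightarrow>\<^sub>0 nat) \<Rightarrow> complex" where
  "sym_entry U \<beta> \<alpha> = Poly_Mapping.lookup (sym_image U \<alpha>) \<beta>"

definition trace_sym :: "nat \<Rightarrow> complex^'n^'n \<Rightarrow> complex" where
  "trace_sym j U = (\<Sum>\<alpha>\<in>exponents j. sym_entry U \<alpha> \<alpha>)"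

lemma finite_exponents: "finite (exponents j :: ('n::finite \<Rightarrow>\<^sub>0 nat) set)"
proof (rule finite_imageD)
  have "Poly_Mapping.lookup ` (exponents j :: ('n \<Rightarrow>\<^sub>0 nat) set) \<subseteq> (UNIV \<rightarrow>\<^sub>E {..j})"
    by (auto simp: exponents_def intro: member_le_sum)
  then show "finite (Poly_Mapping.lookup ` (exponents j :: ('n \<Rightarrow>\<^sub>0 nat) set))"
    by (rule finite_subset) (simp add: finite_PiE)
  show "inj_on Poly_Mapping.lookup (exponents j :: ('n \<Rightarrow>\<^sub>0 nat) set)"
    by (simp add: inj_on_def poly_mapping_eqI)
qed

text \<open>On diagonal matrices the trace is the complete homogeneous symmetric polynomial of the
  diagonal entries.\<close>

lemma trace_sym_diagonal:
  fixes x :: "'n::finite \<Rightarrow> complex"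
  shows "trace_sym j (\<chi> i k. if i = k then x i else 0) =
    (\<Sum>\<alpha>\<in>exponents j. \<Prod>i\<in>UNIV. x i ^ Poly_Mapping.lookup \<alpha> i)"
proof -
  let ?D = "(\<chi> i k. if i = k then x i else 0) :: complex^'n^'n"
  have col: "column_form ?D i = Poly_Mapping.single (Poly_Mapping.single i 1) (x i)" for i
  proof -
    have "column_form ?D i = (\<Sum>k\<in>UNIV. if k = i
        then Poly_Mapping.single (Poly_Mapping.single k 1) (x k) else 0)"
      unfolding column_form_def by (intro sum.cong) auto
    then show ?thesis by simp
  qed
  have pow: "Poly_Mapping.single (Poly_Mapping.single i 1) c ^ n =
      Poly_Mapping.single (Poly_Mapping.single i n) (c ^ n)" for i :: 'n and c :: complex and n :: nat
    by (induction n) (simp_all add: mult_single flip: single_add)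
  have prd: "(\<Prod>i\<in>I. Poly_Mapping.single (f i) (c i)) =
      Poly_Mapping.single (\<Sum>i\<in>I. f i) (\<Prod>i\<in>I. c i)"
    if "finite I" for I :: "'n set" and f :: "'n \<Rightarrow> ('n \<Rightarrow>\<^sub>0 nat)" and c :: "'n \<Rightarrow> complex"
    using that by (induction I) (simp_all add: mult_single)
  have mono: "(\<Sum>i\<in>UNIV. Poly_Mapping.single i (Poly_Mapping.lookup \<alpha> i)) = \<alpha>"
    for \<alpha> :: "'n \<Rightarrow>\<^sub>0 nat"
    by (rule poly_mapping_eqI) (simp add: lookup_sum lookup_single when_def)
  show ?thesis
    unfolding trace_sym_def sym_entry_def sym_image_def
    by (simp only: col pow prd mono finite lookup_single_eq)
qed

text \<open>A partition is the weakly decreasing list of its parts.\<close>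

definition partition_with_multiplicities :: "nat \<Rightarrow> (nat \<Rightarrow> nat) \<Rightarrow> nat list \<Rightarrow> bool" where
  "partition_with_multiplicities l a \<mu> \<longleftrightarrow>
     sorted_wrt (\<ge>) \<mu> \<and> set \<mu> \<subseteq> {1..l} \<and> (\<forall>j\<in>{1..l}. count_list \<mu> j = a j)"

text \<open>An $m \times n$ matrix is a function on its index set, indices starting at 0.  The extensional
  function space makes the values outside the index set irrelevant, so that each matrix is counted
  exactly once.\<close>

definition nat_matrices :: "nat \<Rightarrow> nat \<Rightarrow> (nat \<times> nat \<Rightarrow> nat) set" where
  "nat_matrices m n = ({..<m} \<times> {..<n}) \<rightarrow>\<^sub>E UNIV"

definition row_sums :: "nat \<Rightarrow> nat \<Rightarrow> (nat \<times> nat \<Rightarrow> nat) \<Rightarrow> nat list" where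
  "row_sums m n A = map (\<lambda>i. \<Sum>j<n. A (i, j)) [0..<m]"

definition col_sums :: "nat \<Rightarrow> nat \<Rightarrow> (nat \<times> nat \<Rightarrow> nat) \<Rightarrow> nat list" where
  "col_sums m n A = map (\<lambda>j. \<Sum>i<m. A (i, j)) [0..<n]"

definition contingency_matrices :: "nat list \<Rightarrow> nat list \<Rightarrow> (nat \<times> nat \<Rightarrow> nat) set" where
  "contingency_matrices \<mu> \<nu> = {A \<in> nat_matrices (length \<mu>) (length \<nu>).
     row_sums (length \<mu>) (length \<nu>) A = \<mu> \<and> col_sums (length \<mu>) (length \<nu>) A = \<nu>}"

definition contingency_number :: "nat list \<Rightarrow> nat list \<Rightarrow> nat" where
  "contingency_number \<mu> \<nu> = card (contingency_matrices \<mu> \<nu>)"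

lemma finite_contingency_matrices: "finite (contingency_matrices \<mu> \<nu>)"
proof (rule finite_subset)
  let ?m = "length \<mu>" and ?n = "length \<nu>"
  show "contingency_matrices \<mu> \<nu> \<subseteq> ({..<?m} \<times> {..<?n}) \<rightarrow>\<^sub>E {..sum_list \<mu>}"
  proof
    fix A assume A: "A \<in> contingency_matrices \<mu> \<nu>"
    have "A (i, j) \<le> sum_list \<mu>" if "i < ?m" "j < ?n" for i j
    proof -
      have "A (i, j) \<le> (\<Sum>j<?n. A (i, j))"
        using that by (intro member_le_sum) auto
      also have "\<dots> = row_sums ?m ?n A ! i"
        using that by (simp add: row_sums_def)
      also have "\<dots> = \<mu> ! i"
        using A by (simp add: contingency_matrices_def)
      also have "\<dots> \<le> sum_list \<mu>"
        using that by (intro member_le_sum_list) auto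
      finally show ?thesis .
    qed
    then show "A \<in> ({..<?m} \<times> {..<?n}) \<rightarrow>\<^sub>E {..sum_list \<mu>}"
      using A by (auto simp: contingency_matrices_def nat_matrices_def PiE_iff)
  qed
qed (simp add: finite_PiE)

end

theory Submission imports Defs begin

text \<open>Put $m = \ell(\mu)$, $n = \ell(\widetilde\mu)$; conjugating the integral, assume $m \le N$. The integrand
  is the trace of $U$ on the space of polynomials $f(z_1, \dots, z_m, y_1, \dots, y_n)$ in
  $N$-dimensional vectors that are homogeneous of degree $\mu_i$ in $z_i$ and $\widetilde\mu_j$ in
  $y_j$, where $U$ acts on the $z_i$ and $\overline U$ on the $y_j$. Averaging over the group is a
  projection onto the invariant polynomials, so the integral is the dimension of that space.

  An invariant $f$ satisfies $f(zg, y) = f(z, y g^T)$ for every unitary $g$, hence (unitary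
  trick) for every matrix $g$, invertible or not. As $m \le N$, there is a $g$ whose first $m$ rows are
  $z_1, \dots, z_m$ and whose other rows vanish, and $z = (e_1, \dots, e_m) g$. So $f(z, y) = f(e, y g^T)$
  is a polynomial in the pairings $z_i \cdot y_j$, and the monomials
  $\prod_{i,j} (z_i \cdot y_j)^{a_{ij}}$ with row sums $\mu$ and column sums $\widetilde\mu$ are a basis.\<close>

section \<open>Monomials\<close>

text \<open>Polynomials are handled as functions of a family \<open>T\<close> of row vectors, the
  first m being the $z_i$ and the rest the $y_j$. Since matrices act on row vectors from the right,
  translating \<open>T\<close> by V turns U into VU under the integral, which is what left
  invariance absorbs.

  The unitary trick runs along lines. In Cayley form a unitary matrix is a quotient of 1 + B and 1 -
  B; the denominator is cleared by moving factors to the other side of the invariance identity, so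
  both sides become polynomial in B. Now B ranges over the skew-Hermitian matrices, a real form of
  all matrices, and one-variable identities pass from real to complex parameters.

  That the pairing monomials form a basis is never proved as such. The trace only needs that
  invariants are combinations of them, and that those of the right degree are fixed by averaging and
  have coefficient 1 at a distinguished monomial. The bound m <= N enters as an injection
  \<open>\<iota>\<close> of the indices of the $z_i$ into the coordinates, which yields both the
  frame and the distinguished monomials.\<close>

definition monomial_value :: "complex^'n \<Rightarrow> ('n \<Rightarrow>\<^sub>0 nat) \<Rightarrow> complex" where
  "monomial_value x \<alpha> = (\<Prod>p\<in>UNIV. x $ p ^ Poly_Mapping.lookup \<alpha> p)"

text \<open>Evaluation is a ring homomorphism from the formal symmetric algebra to functions;
  through it \<open>sym_entry\<close> can be studied as a substitution.\<close>

definition poly_value :: "complex^'n \<Rightarrow> (('n \<Rightarrow>\<^sub>0 nat) \<Rightarrow>\<^sub>0 complex) \<Rightarrow> complex" where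
  "poly_value x P = (\<Sum>\<alpha>\<in>Poly_Mapping.keys P. Poly_Mapping.lookup P \<alpha> * monomial_value x \<alpha>)"

lemma monomial_value_add: "monomial_value x (\<alpha> + \<beta>) = monomial_value x \<alpha> * monomial_value x \<beta>"
  by (simp add: monomial_value_def lookup_add power_add prod.distrib)

lemma poly_value_superset:
  assumes "finite S" "Poly_Mapping.keys P \<subseteq> S"
  shows "poly_value x P = (\<Sum>\<alpha>\<in>S. Poly_Mapping.lookup P \<alpha> * monomial_value x \<alpha>)"
  unfolding poly_value_def using assms
  by (intro sum.mono_neutral_left) (auto simp: in_keys_iff)

lemma poly_value_add: "poly_value x (P + Q) = poly_value x P + poly_value x Q"
proof -
  let ?S = "Poly_Mapping.keys P \<union> Poly_Mapping.keys Q"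
  have "Poly_Mapping.keys (P + Q) \<subseteq> ?S"
    by (rule keys_add)
  then show ?thesis
    by (simp add: poly_value_superset[of ?S] lookup_add distrib_right sum.distrib)
qed

lemma poly_value_0: "poly_value x 0 = 0"
  by (simp add: poly_value_def)

lemma poly_value_sum: "poly_value x (\<Sum>i\<in>I. P i) = (\<Sum>i\<in>I. poly_value x (P i))"
  by (induction I rule: infinite_finite_induct) (simp_all add: poly_value_0 poly_value_add)

lemma poly_value_single: "poly_value x (Poly_Mapping.single \<alpha> c) = c * monomial_value x \<alpha>"
  by (simp add: poly_value_def)

lemma poly_value_mult: "poly_value x (P * Q) = poly_value x P * poly_value x Q"
proof -
  have expand: "R = (\<Sum>\<alpha>\<in>Poly_Mapping.keys R. Poly_Mapping.single \<alpha> (Poly_Mapping.lookup R \<alpha>))"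
    for R :: "('n \<Rightarrow>\<^sub>0 nat) \<Rightarrow>\<^sub>0 complex"
    by (rule poly_mapping_eqI)
      (simp add: lookup_sum lookup_single when_def in_keys_iff)
  have "P * Q = (\<Sum>\<alpha>\<in>Poly_Mapping.keys P. \<Sum>\<beta>\<in>Poly_Mapping.keys Q.
      Poly_Mapping.single (\<alpha> + \<beta>) (Poly_Mapping.lookup P \<alpha> * Poly_Mapping.lookup Q \<beta>))"
    by (subst expand[of P], subst expand[of Q]) (simp add: sum_product mult_single)
  then show ?thesis
    by (simp add: poly_value_sum poly_value_single monomial_value_add)
      (simp add: poly_value_def sum_product mult_ac)
qed

lemma poly_value_1: "poly_value x 1 = 1"
  by (simp add: poly_value_def monomial_value_def)

lemma poly_value_power: "poly_value x (P ^ k) = poly_value x P ^ k"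
  by (induct k) (simp_all only: power_0 power_Suc poly_value_1 poly_value_mult)

lemma poly_value_prod: "poly_value x (\<Prod>i\<in>I. P i) = (\<Prod>i\<in>I. poly_value x (P i))"
  by (induct I rule: infinite_finite_induct)
    (simp_all only: not_False_eq_True prod.infinite prod.empty prod.insert poly_value_1 poly_value_mult)

lemma exponents_add:
  "\<alpha> \<in> exponents j \<Longrightarrow> \<beta> \<in> exponents k \<Longrightarrow> \<alpha> + \<beta> \<in> exponents (j + k)"
  by (simp add: exponents_def lookup_add sum.distrib)

lemma exponents_single: "Poly_Mapping.single p k \<in> exponents k"
  by (simp add: exponents_def lookup_single when_def)

lemma keys_mult_exponents:
  assumes "Poly_Mapping.keys P \<subseteq> exponents j" "Poly_Mapping.keys Q \<subseteq> exponents k"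
  shows "Poly_Mapping.keys (P * Q) \<subseteq> exponents (j + k)"
proof
  fix \<gamma> assume "\<gamma> \<in> Poly_Mapping.keys (P * Q)"
  then obtain \<alpha> \<beta> where "\<gamma> = \<alpha> + \<beta>" "\<alpha> \<in> Poly_Mapping.keys P" "\<beta> \<in> Poly_Mapping.keys Q"
    using keys_mult[of P Q] by auto
  then show "\<gamma> \<in> exponents (j + k)"
    using assms by (auto intro: exponents_add)
qed

lemma keys_1_exponents: "Poly_Mapping.keys (1 :: ('n::finite \<Rightarrow>\<^sub>0 nat) \<Rightarrow>\<^sub>0 complex) \<subseteq> exponents 0"
  by (simp add: exponents_def)

lemma keys_power_exponents:
  assumes "Poly_Mapping.keys (P :: ('n::finite \<Rightarrow>\<^sub>0 nat) \<Rightarrow>\<^sub>0 complex) \<subseteq> exponents j"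
  shows "Poly_Mapping.keys (P ^ k) \<subseteq> exponents (j * k)"
proof (induction k)
  case 0
  then show ?case by (simp only: keys_1_exponents power_0 mult_0_right)
next
  case (Suc k)
  then show ?case using keys_mult_exponents[OF assms Suc] by (simp only: power_Suc mult_Suc_right)
qed

lemma keys_prod_exponents:
  assumes "\<And>i. i \<in> I \<Longrightarrow>
    Poly_Mapping.keys (P i :: ('n::finite \<Rightarrow>\<^sub>0 nat) \<Rightarrow>\<^sub>0 complex) \<subseteq> exponents (j i)"
  shows "Poly_Mapping.keys (\<Prod>i\<in>I. P i) \<subseteq> exponents (\<Sum>i\<in>I. j i)"
  using assms
proof (induction I rule: infinite_finite_induct)
  case (insert i I)
  then show ?case
    using keys_mult_exponents[of "P i" "j i" "prod P I" "sum j I"]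
    by (simp only: not_False_eq_True prod.insert sum.insert insertI1 insertI2)
qed (simp_all only: keys_1_exponents not_False_eq_True prod.infinite prod.empty sum.infinite sum.empty)

text \<open>Each \<open>column_form\<close> is linear, so replacing the variables of a degree j
  monomial by column forms keeps the degree; no other exponents contribute to the image.\<close>

lemma keys_sym_image:
  assumes "\<alpha> \<in> exponents j"
  shows "Poly_Mapping.keys (sym_image U \<alpha>) \<subseteq> exponents j"
proof -
  have "Poly_Mapping.keys (column_form U p) \<subseteq> exponents 1" for p
    unfolding column_form_def
    by (rule subset_trans[OF keys_sum]) (auto simp: exponents_single split: if_splits)
  then have "Poly_Mapping.keys (sym_image U \<alpha>) \<subseteq>
      exponents (\<Sum>p\<in>UNIV. 1 * Poly_Mapping.lookup \<alpha> p)"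
    unfolding sym_image_def by (intro keys_prod_exponents keys_power_exponents)
  then show ?thesis using assms by (simp add: exponents_def)
qed

lemma monomial_value_single: "monomial_value x (Poly_Mapping.single p k) = x $ p ^ k"
proof -
  have "monomial_value x (Poly_Mapping.single p k) = (\<Prod>q\<in>UNIV. if q = p then x $ p ^ k else 1)"
    unfolding monomial_value_def by (intro prod.cong) (auto simp: lookup_single when_def)
  then show ?thesis by simp
qed

text \<open>The value of \<open>column_form U p\<close> at x is coordinate p of
  \<open>x v* U\<close>. Thus the symmetric power of U is the substitution of xU for x in forms, and
  \<open>sym_entry U\<close> is its matrix in the monomial basis.\<close>

lemma monomial_value_vector_matrix:
  assumes "\<alpha> \<in> exponents j"
  shows "monomial_value (x v* U) \<alpha> = (\<Sum>\<beta>\<in>exponents j. sym_entry U \<beta> \<alpha> * monomial_value x \<beta>)"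
proof -
  have "poly_value x (column_form U p) = (x v* U) $ p" for p
    by (simp add: column_form_def poly_value_sum poly_value_single monomial_value_single
        vector_matrix_mult_def mult.commute)
  then have "monomial_value (x v* U) \<alpha> = poly_value x (sym_image U \<alpha>)"
    by (simp add: monomial_value_def sym_image_def poly_value_prod poly_value_power)
  also have "\<dots> = (\<Sum>\<beta>\<in>exponents j. sym_entry U \<beta> \<alpha> * monomial_value x \<beta>)"
    unfolding sym_entry_def by (intro poly_value_superset finite_exponents keys_sym_image assms)
  finally show ?thesis .
qed

text \<open>Averaging against a character of the $q$-th roots of unity extracts the coefficient of $x^a$.
  For $a = 0$ evaluation at $0$ is used instead, so that the multivariate coefficient functional
  below depends only on the restriction to points vanishing wherever the exponent does.\<close>

lemma power_dual_weights:
  fixes q a :: nat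
  assumes "a < q"
  obtains X :: "complex set" and w :: "complex \<Rightarrow> complex" where "finite X"
    and "\<And>b. b < q \<Longrightarrow> (\<Sum>x\<in>X. w x * x ^ b) = (if b = a then 1 else 0)"
    and "\<And>x. x \<in> X \<Longrightarrow> a = 0 \<Longrightarrow> x = 0"
proof (cases "a = 0")
  case True
  show ?thesis
    by (rule that[of "{0}" "\<lambda>_. 1"]) (auto simp: True power_0_left)
next
  case False
  let ?X = "{z :: complex. z ^ q = 1}"
  have q: "q > 0" using assms by simp
  define r where "r k = exp (2 * of_real pi * \<i> * of_nat k / of_nat q)" for k :: nat
  have r_mult: "r k ^ c = r (k * c)" for k c
    by (simp add: r_def exp_of_nat_mult[symmetric] mult_ac)
  have r_1: "r c = 1 \<longleftrightarrow> q dvd c" for c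
    using q by (simp add: r_def complex_root_unity_eq_1)
  have X: "?X = r ` {..<q}" and inj: "inj_on r {..<q}"
    using q complex_roots_unity[of q] bij_betw_roots_unity[of q]
    unfolding r_def by (auto simp: bij_betw_def)
  show ?thesis
  \<comment> \<open>On the q-th roots of unity \<open>x ^ (q - a)\<close> is the inverse of
    \<open>x ^ a\<close>, written with a natural exponent.\<close>
  proof (rule that[of ?X "\<lambda>x. x ^ (q - a) / of_nat q"])
    show "finite ?X" unfolding X by simp
    fix b assume b: "b < q"
    let ?c = "q - a + b"
    have "(\<Sum>x\<in>?X. x ^ (q - a) / of_nat q * x ^ b) = (\<Sum>k<q. r k ^ ?c) / of_nat q"
      unfolding X sum.reindex[OF inj] by (simp add: sum_divide_distrib power_add)
    also have "(\<Sum>k<q. r k ^ ?c) = (\<Sum>k<q. r ?c ^ k)"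
      by (simp only: r_mult mult.commute)
    finally have eq: "(\<Sum>x\<in>?X. x ^ (q - a) / of_nat q * x ^ b) = (\<Sum>k<q. r ?c ^ k) / of_nat q" .
    show "(\<Sum>x\<in>?X. x ^ (q - a) / of_nat q * x ^ b) = (if b = a then 1 else 0)"
    proof (cases "b = a")
      case True
      then have "r ?c = 1" using assms by (simp add: r_1)
      then show ?thesis unfolding eq using True q by simp
    next
      case neq: False
      \<comment> \<open>\<open>?c\<close> lies strictly between 0 and \<open>2 * q\<close>, so q can
        divide it only if it equals q, that is, if b = a.\<close>
      have "\<not> q dvd ?c"
      proof
        assume "q dvd ?c"
        then obtain k where k: "?c = q * k" ..
        have "?c > 0" "?c < 2 * q" using assms b by auto
        then have "k = 1" unfolding k using q by (cases k; cases "k - 1") auto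
        then show False using k neq assms by simp
      qed
      then have "r ?c \<noteq> 1" by (simp add: r_1)
      moreover have "r ?c ^ q = 1" by (simp add: r_mult r_1)
      ultimately show ?thesis unfolding eq using neq by (simp add: geometric_sum)
    qed
  qed (use False in auto)
qed

text \<open>Product weights on a grid: the sum over the grid factors into one-variable sums. A
  direction with \<open>d i = 0\<close> contributes only the point 0 to the grid.\<close>

lemma monomial_dual_weights:
  fixes I :: "'i set" and q :: nat and d :: "'i \<Rightarrow> nat"
  assumes "finite I" "\<And>i. i \<in> I \<Longrightarrow> d i < q"
  shows "\<exists>X w. finite X \<and>
    (\<forall>e. (\<forall>i\<in>I. e i < q) \<longrightarrow>
      (\<Sum>x\<in>X. w x * (\<Prod>i\<in>I. x i ^ e i)) = (if \<forall>i\<in>I. e i = d i then 1 else (0::complex))) \<and>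
    (\<forall>x\<in>X. \<forall>i\<in>I. d i = 0 \<longrightarrow> x i = 0)"
proof -
  define dual where "dual a p \<longleftrightarrow> finite (fst p) \<and>
      (\<forall>b<q. (\<Sum>x\<in>fst p. snd p x * x ^ b) = (if b = a then 1 else 0)) \<and>
      (\<forall>x\<in>fst p. a = 0 \<longrightarrow> x = 0)" for a :: nat and p :: "complex set \<times> (complex \<Rightarrow> complex)"
  have "\<forall>i\<in>I. \<exists>p. dual (d i) p"
  proof
    fix i assume "i \<in> I"
    with assms(2) have "d i < q" by blast
    then obtain X w where "dual (d i) (X, w)"
      unfolding dual_def fst_conv snd_conv by (rule power_dual_weights) auto
    then show "\<exists>p. dual (d i) p" ..
  qed
  from bchoice[OF this] obtain p where p: "\<forall>i\<in>I. dual (d i) (p i)" ..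
  define X w where "X i = fst (p i)" and "w i = snd (p i)" for i
  have fin: "finite (X i)" if "i \<in> I" for i
    using p that by (simp add: dual_def X_def)
  have dual: "(\<Sum>x\<in>X i. w i x * x ^ b) = (if b = d i then 1 else 0)" if "i \<in> I" "b < q" for i b
    using p that by (simp add: dual_def X_def w_def)
  have zero: "x = 0" if "i \<in> I" "x \<in> X i" "d i = 0" for i x
    using p that by (simp add: dual_def X_def)
  show ?thesis
  proof (intro exI[of _ "PiE I X"] exI[of _ "\<lambda>x. \<Prod>i\<in>I. w i (x i)"] conjI allI impI ballI)
    show "finite (PiE I X)" by (intro finite_PiE assms fin)
    fix e :: "'i \<Rightarrow> nat" assume "\<forall>i\<in>I. e i < q"
    then have e: "e i < q" if "i \<in> I" for i using that by blast
    have "(\<Sum>x\<in>PiE I X. (\<Prod>i\<in>I. w i (x i)) * (\<Prod>i\<in>I. x i ^ e i)) =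
        (\<Sum>x\<in>PiE I X. \<Prod>i\<in>I. w i (x i) * x i ^ e i)"
      by (simp add: prod.distrib)
    also have "\<dots> = (\<Prod>i\<in>I. \<Sum>x\<in>X i. w i x * x ^ e i)"
      by (intro prod_sum_PiE[symmetric] assms fin)
    also have "\<dots> = (\<Prod>i\<in>I. if e i = d i then 1 else 0)"
      by (intro prod.cong refl dual e)
    also have "\<dots> = (if \<forall>i\<in>I. e i = d i then 1 else 0)"
    proof (cases "\<forall>i\<in>I. e i = d i")
      case False
      then have "(\<Prod>i\<in>I. if e i = d i then 1 else 0 :: complex) = 0"
        by (intro prod_zero assms) auto
      with False show ?thesis by simp
    qed simp
    finally show "(\<Sum>x\<in>PiE I X. (\<Prod>i\<in>I. w i (x i)) * (\<Prod>i\<in>I. x i ^ e i)) =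
        (if \<forall>i\<in>I. e i = d i then 1 else 0)" .
  qed (use zero in \<open>auto simp: PiE_iff\<close>)
qed

section \<open>The unitary trick\<close>

definition polyfun :: "(complex \<Rightarrow> complex) \<Rightarrow> bool" where
  "polyfun h \<longleftrightarrow> (\<exists>P. \<forall>t. h t = poly P t)"

lemma polyfun_const: "polyfun (\<lambda>_. c)"
  unfolding polyfun_def by (rule exI[of _ "[:c:]"]) simp

lemma polyfun_ident: "polyfun (\<lambda>t. t)"
  unfolding polyfun_def by (rule exI[of _ "[:0, 1:]"]) simp

lemma polyfun_add: "polyfun f \<Longrightarrow> polyfun g \<Longrightarrow> polyfun (\<lambda>t. f t + g t)"
  unfolding polyfun_def by (auto simp flip: poly_add)

lemma polyfun_mult: "polyfun f \<Longrightarrow> polyfun g \<Longrightarrow> polyfun (\<lambda>t. f t * g t)"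
  unfolding polyfun_def by (auto simp flip: poly_mult)

lemma polyfun_diff: "polyfun f \<Longrightarrow> polyfun g \<Longrightarrow> polyfun (\<lambda>t. f t - g t)"
  unfolding polyfun_def by (auto simp flip: poly_diff)

lemma polyfun_power: "polyfun f \<Longrightarrow> polyfun (\<lambda>t. f t ^ k)"
  unfolding polyfun_def by (auto simp flip: poly_power)

lemma polyfun_sum: "(\<And>i. i \<in> I \<Longrightarrow> polyfun (f i)) \<Longrightarrow> polyfun (\<lambda>t. \<Sum>i\<in>I. f i t)"
  by (induction I rule: infinite_finite_induct) (simp_all add: polyfun_const polyfun_add)

lemma polyfun_prod: "(\<And>i. i \<in> I \<Longrightarrow> polyfun (f i)) \<Longrightarrow> polyfun (\<lambda>t. \<Prod>i\<in>I. f i t)"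
  by (induction I rule: infinite_finite_induct) (simp_all add: polyfun_const polyfun_mult)

lemma polyfun_divide: "polyfun f \<Longrightarrow> polyfun (\<lambda>t. f t / c)"
  unfolding divide_inverse by (rule polyfun_mult[OF _ polyfun_const])

lemmas polyfun_intros = polyfun_divide polyfun_const polyfun_ident polyfun_add polyfun_mult polyfun_diff
  polyfun_power polyfun_sum polyfun_prod

lemma polyfun_det:
  assumes "\<And>i j. polyfun (\<lambda>t. A t $ i $ j)"
  shows "polyfun (\<lambda>t. det (A t :: complex^'n^'n))"
  unfolding det_def by (intro polyfun_intros assms)

text \<open>The product \<open>d t * (f t - g t)\<close> vanishes at all real points, which are
  infinitely many, so it is the zero polynomial; being nonzero at 0, \<open>d\<close> can be
  cancelled. In the applications \<open>d\<close> is the determinant that has to be nonzero for the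
  identity to be available.\<close>

lemma polyfun_eqI:
  assumes "polyfun f" "polyfun g" "polyfun d" "d 0 \<noteq> 0"
    and eq: "\<And>s::real. d (of_real s) \<noteq> 0 \<Longrightarrow> f (of_real s) = g (of_real s)"
  shows "f t = g t"
proof -
  have "polyfun (\<lambda>t. d t * (f t - g t))"
    by (intro polyfun_intros assms)
  then obtain P where P: "\<And>t. d t * (f t - g t) = poly P t"
    unfolding polyfun_def by blast
  obtain Q where Q: "\<And>t. d t = poly Q t"
    using assms(3) unfolding polyfun_def by blast
  obtain R where R: "\<And>t. f t - g t = poly R t"
    using polyfun_diff[OF assms(1,2)] unfolding polyfun_def by blast
  have "poly P (of_real s) = 0" for s :: real
    using eq[of s] P[of "of_real s"] by (cases "d (of_real s) = 0") auto
  then have "range (of_real :: real \<Rightarrow> complex) \<subseteq> {t. poly P t = 0}"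
    by auto
  moreover have "infinite (range (of_real :: real \<Rightarrow> complex))"
    by (simp add: finite_image_iff inj_on_def infinite_UNIV_char_0)
  ultimately have "infinite {t. poly P t = 0}"
    by (rule infinite_super)
  then have "P = 0"
    using poly_roots_finite[of P] by (cases "P = 0") simp_all
  have "poly (Q * R) = poly 0"
    using P \<open>P = 0\<close> by (intro ext) (simp flip: Q R)
  then have "Q * R = 0"
    by (simp only: poly_eq_poly_eq_iff)
  moreover have "Q \<noteq> 0"
    using assms(4) Q by auto
  ultimately have "R = 0" by simp
  then show ?thesis using R[of t] by simp
qed

text \<open>All continuation arguments move one parameter along a curve, so polynomiality in many
  variables is recorded only through its restrictions to polynomial curves.\<close>

definition polynomial_on_curves :: "((nat \<Rightarrow> complex^'n) \<Rightarrow> complex) \<Rightarrow> bool" where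
  "polynomial_on_curves f \<longleftrightarrow>
     (\<forall>T. (\<forall>k p. polyfun (\<lambda>t. T t k $ p)) \<longrightarrow> polyfun (\<lambda>t. f (T t)))"

text \<open>The two matrices are independent, so that arbitrary pairs can act and not only a unitary
  matrix with its conjugate.\<close>

definition act :: "nat \<Rightarrow> complex^'n^'n \<Rightarrow> complex^'n^'n \<Rightarrow> (nat \<Rightarrow> complex^'n) \<Rightarrow> nat \<Rightarrow> complex^'n" where
  "act m g h T k = (if k < m then T k v* g else T k v* h)"

definition matrix_cnj :: "complex^'n^'n \<Rightarrow> complex^'n^'n" where
  "matrix_cnj U = (\<chi> i j. cnj (U $ i $ j))"

definition unitary_invariant :: "nat \<Rightarrow> ((nat \<Rightarrow> complex^'n) \<Rightarrow> complex) \<Rightarrow> bool" where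
  "unitary_invariant m f \<longleftrightarrow> (\<forall>V\<in>unitary_group. \<forall>T. f (act m V (matrix_cnj V) T) = f T)"

lemma vector_matrix_mul_assoc: "(x v* A) v* B = x v* (A ** (B :: complex^'n^'n))"
  by (simp add: matrix_vector_mul_assoc matrix_transpose_mul flip: transpose_matrix_vector)

lemma act_act: "act m g h (act m g' h' T) = act m (g' ** g) (h' ** h) T"
  by (rule ext) (simp add: act_def vector_matrix_mul_assoc)

lemma polyfun_act:
  assumes "polynomial_on_curves f"
    and "\<And>i j. polyfun (\<lambda>t. A t $ i $ j)" "\<And>i j. polyfun (\<lambda>t. B t $ i $ j)"
  shows "polyfun (\<lambda>t. f (act m (A t) (B t) T))"
proof -
  have "polyfun (\<lambda>t. act m (A t) (B t) T k $ p)" for k p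
    unfolding act_def vector_matrix_mult_def
    by (cases "k < m") (simp_all add: polyfun_intros assms)
  then show ?thesis
    using assms(1) by (simp add: polynomial_on_curves_def)
qed

section \<open>Matrix algebra and the Cayley transform\<close>

lemma matrix_mult_rdistrib: "(A + B) ** C = A ** C + B ** (C :: complex^'n^'n)"
  by (simp add: matrix_matrix_mult_def vec_eq_iff algebra_simps sum.distrib)

lemma matrix_mult_diff:
  "(A - B) ** C = A ** C - B ** (C :: complex^'n^'n)" "A ** (B - C) = A ** B - A ** C"
  by (simp_all add: matrix_matrix_mult_def vec_eq_iff algebra_simps sum_subtractf)

lemma conj_transpose_mult: "conj_transpose (A ** B) = conj_transpose B ** conj_transpose A"
  by (simp add: conj_transpose_def matrix_matrix_mult_def vec_eq_iff mult.commute)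

lemma matrix_cnj_mult: "matrix_cnj (A ** B) = matrix_cnj A ** matrix_cnj B"
  by (simp add: matrix_cnj_def matrix_matrix_mult_def vec_eq_iff)

lemma conj_transpose_1: "conj_transpose (mat 1) = mat 1"
  by (simp add: conj_transpose_def mat_def vec_eq_iff)

lemma conj_transpose_conj_transpose: "conj_transpose (conj_transpose A) = A"
  by (simp add: conj_transpose_def vec_eq_iff)

lemma unitary_groupI:
  assumes "V ** conj_transpose V = mat 1"
  shows "V \<in> unitary_group"
  using assms by (simp add: unitary_group_def matrix_left_right_inverse)

text \<open>If $C$ is normal and invertible, $C^{-1} C^*$ is unitary (the Cayley transform).\<close>

lemma unitary_invariant_normal:
  assumes f: "unitary_invariant m f"
    and normal: "C ** D = D ** C" and D: "D = conj_transpose C" and "det C \<noteq> 0"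
  shows "f (act m D (transpose C) T) = f (act m C (transpose D) T)"
proof -
  from \<open>det C \<noteq> 0\<close> obtain E where E: "C ** E = mat 1" "E ** C = mat 1"
    using invertible_det_nz unfolding invertible_def by blast
  define V where "V = E ** D"
  have "V ** conj_transpose V = E ** (D ** C) ** conj_transpose E"
    by (simp add: V_def D conj_transpose_mult conj_transpose_conj_transpose matrix_mul_assoc)
  also have "\<dots> = (E ** C) ** (D ** conj_transpose E)"
    by (simp only: normal[symmetric] matrix_mul_assoc)
  also have "D ** conj_transpose E = conj_transpose (E ** C)"
    by (simp add: D conj_transpose_mult)
  finally have V: "V \<in> unitary_group"
    by (intro unitary_groupI) (simp add: E conj_transpose_1)
  have CV: "C ** V = D"
    by (simp add: V_def matrix_mul_assoc E)
  \<comment> \<open>As D is the adjoint of C, the pair (C, \<open>transpose D\<close>) is C with its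
    entrywise conjugate; V carries it to D with its entrywise conjugate, which is the pair (D,
    \<open>transpose C\<close>).\<close>
  have "transpose D = matrix_cnj C" "transpose C = matrix_cnj D"
    by (simp_all add: D transpose_def matrix_cnj_def conj_transpose_def vec_eq_iff)
  then have "act m V (matrix_cnj V) (act m C (transpose D) T) = act m D (transpose C) T"
    by (simp add: act_act CV flip: matrix_cnj_mult)
  then show ?thesis
    using f[unfolded unitary_invariant_def, rule_format, OF V, of "act m C (transpose D) T"] by simp
qed

context
  fixes m :: nat and f :: "(nat \<Rightarrow> complex^'n) \<Rightarrow> complex"
  assumes inv: "unitary_invariant m f" and poly: "polynomial_on_curves f"
begin

lemma polyfun_cayley:
  assumes S: "\<And>i j. polyfun (\<lambda>t. S t $ i $ j)"
  shows "polyfun (\<lambda>t. f (act m (mat 1 + S t) (transpose (mat 1 - S t)) T))"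
    and "polyfun (\<lambda>t. f (act m (mat 1 - S t) (transpose (mat 1 + S t)) T))"
proof -
  have *: "polyfun (\<lambda>t. (mat 1 + S t) $ i $ j)" "polyfun (\<lambda>t. (mat 1 - S t) $ i $ j)"
    "polyfun (\<lambda>t. transpose (mat 1 + S t) $ i $ j)" "polyfun (\<lambda>t. transpose (mat 1 - S t) $ i $ j)" for i j
    unfolding transpose_def vec_lambda_beta vector_add_component vector_minus_component
    by (intro polyfun_add polyfun_diff polyfun_const S)+
  show "polyfun (\<lambda>t. f (act m (mat 1 + S t) (transpose (mat 1 - S t)) T))"
    and "polyfun (\<lambda>t. f (act m (mat 1 - S t) (transpose (mat 1 + S t)) T))"
    by (intro polyfun_act[OF poly] *)+
qed

text \<open>The case C = 1 - B of the Cayley transform: the adjoint is 1 + B, which commutes with C.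
  Replacing B by tB gives a determinant that is nonzero at t = 0, and the identity reaches t = 1 by
  polynomiality instead of by inverting 1 - B.\<close>

lemma invariant_skew:
  assumes "conj_transpose B = - B"
  shows "f (act m (mat 1 + B) (transpose (mat 1 - B)) T) = f (act m (mat 1 - B) (transpose (mat 1 + B)) T)"
proof -
  define S where "S t = (\<chi> i j. t * B $ i $ j)" for t
  let ?F = "\<lambda>t. f (act m (mat 1 + S t) (transpose (mat 1 - S t)) T)"
  let ?G = "\<lambda>t. f (act m (mat 1 - S t) (transpose (mat 1 + S t)) T)"
  have "?F 1 = ?G 1"
  proof (rule polyfun_eqI[where f = ?F and g = ?G and d = "\<lambda>t. det (mat 1 - S t)"])
    have S: "polyfun (\<lambda>t. S t $ i $ j)" for i j
      unfolding S_def vec_lambda_beta by (intro polyfun_intros)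
    show "polyfun ?F" "polyfun ?G"
      by (intro polyfun_cayley S)+
    show "polyfun (\<lambda>t. det (mat 1 - S t))"
      by (rule polyfun_det)
        (simp only: vector_add_component vector_minus_component polyfun_add polyfun_diff polyfun_const S)
    have "S 0 = 0" by (simp add: S_def vec_eq_iff)
    then show "det (mat 1 - S 0) \<noteq> 0" by simp
    fix s :: real
    assume nz: "det (mat 1 - S (of_real s)) \<noteq> 0"
    have "cnj (B $ j $ i) = - B $ i $ j" for i j
      using assms by (simp add: conj_transpose_def vec_eq_iff)
    then have "mat 1 + S (of_real s) = conj_transpose (mat 1 - S (of_real s))"
      by (simp add: conj_transpose_def S_def vec_eq_iff mat_def)
    moreover have "(mat 1 - S (of_real s)) ** (mat 1 + S (of_real s)) =
        (mat 1 + S (of_real s)) ** (mat 1 - S (of_real s))"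
      by (simp add: matrix_add_ldistrib matrix_mult_rdistrib matrix_mult_diff algebra_simps)
    ultimately show "?F (of_real s) = ?G (of_real s)"
      by (intro unitary_invariant_normal[OF inv _ _ nz])
  qed
  moreover have "S 1 = B" by (simp add: S_def vec_eq_iff)
  ultimately show ?thesis by simp
qed

text \<open>For real $t$ the matrix \<open>S t\<close> below is skew-Hermitian, and \<open>S \<i> = B\<close>.\<close>

lemma invariant_cayley:
  "f (act m (mat 1 + B) (transpose (mat 1 - B)) T) = f (act m (mat 1 - B) (transpose (mat 1 + B)) T)"
proof -
  define S where "S t = (\<chi> i j. (B $ i $ j - cnj (B $ j $ i)) / 2 +
    t * ((B $ i $ j + cnj (B $ j $ i)) / (2 * \<i>)))" for t
  let ?F = "\<lambda>t. f (act m (mat 1 + S t) (transpose (mat 1 - S t)) T)"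
  let ?G = "\<lambda>t. f (act m (mat 1 - S t) (transpose (mat 1 + S t)) T)"
  have "?F \<i> = ?G \<i>"
  proof (rule polyfun_eqI[where f = ?F and g = ?G and d = "\<lambda>t. 1"])
    have S: "polyfun (\<lambda>t. S t $ i $ j)" for i j
      unfolding S_def vec_lambda_beta by (intro polyfun_intros)
    show "polyfun ?F" "polyfun ?G"
      by (intro polyfun_cayley S)+
    show "polyfun (\<lambda>t. 1)" by (rule polyfun_const)
    fix s :: real
    have "conj_transpose (S (of_real s)) = - S (of_real s)"
      by (simp add: conj_transpose_def S_def vec_eq_iff complex_eq_iff field_simps)
    then show "?F (of_real s) = ?G (of_real s)"
      by (rule invariant_skew)
  qed simp
  moreover have "S \<i> = B" by (simp add: S_def vec_eq_iff field_simps)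
  ultimately show ?thesis by simp
qed

text \<open>For $B = (g - 1)(1 + g)^{-1}$ the matrices 1 + B and 1 - B are $2g(1 + g)^{-1}$ and $2(1
  + g)^{-1}$. Letting (1 + g)/2 and its transpose act on \<open>T\<close> beforehand clears the
  common factor and leaves g on one side and 1 on the other.\<close>

lemma invariant_transfer_generic:
  assumes "det (mat 1 + g) \<noteq> 0"
  shows "f (act m g (mat 1) T) = f (act m (mat 1) (transpose g) T)"
proof -
  define s where "s = mat 1 + g"
  from assms obtain D where D: "s ** D = mat 1" "D ** s = mat 1"
    using invertible_det_nz unfolding invertible_def s_def by blast
  define h where "h = (1/2) *\<^sub>R s"
  define B where "B = (g - mat 1) ** D"
  have "mat 1 + B = (s + (g - mat 1)) ** D" "mat 1 - B = (s - (g - mat 1)) ** D"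
    by (simp_all only: B_def matrix_mult_rdistrib[of s] matrix_mult_diff(1)[of s] D)
  then have B: "mat 1 + B = (2 *\<^sub>R g) ** D" "mat 1 - B = (2 *\<^sub>R mat 1) ** D"
    by (simp_all add: s_def scaleR_2)
  have sg: "s ** g = g ** s"
    by (simp add: s_def matrix_add_ldistrib matrix_mult_rdistrib)
  have "h ** (mat 1 + B) = s ** g ** D" "h ** (mat 1 - B) = s ** D"
    by (simp_all add: B h_def matrix_scalar_ac matrix_mul_assoc flip: scalar_matrix_assoc)
  then have 1: "h ** (mat 1 + B) = g" "h ** (mat 1 - B) = mat 1"
    by (simp_all add: sg D flip: matrix_mul_assoc)
  have "(mat 1 + B) ** h = g" "(mat 1 - B) ** h = mat 1"
    by (simp_all add: B h_def matrix_scalar_ac D flip: scalar_matrix_assoc matrix_mul_assoc)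
  then have 2: "transpose h ** transpose (mat 1 - B) = mat 1"
      "transpose h ** transpose (mat 1 + B) = transpose g"
    by (simp_all flip: matrix_transpose_mul)
  show ?thesis
    using invariant_cayley[of B "act m h (transpose h) T"] by (simp add: act_act 1 2)
qed

text \<open>Both sides are polynomial along the line tg, and det(1 + tg) is nonzero at t = 0. This
  admits the g with prescribed rows used later, for which nothing is known about 1 + g.\<close>

lemma invariant_transfer: "f (act m g (mat 1) T) = f (act m (mat 1) (transpose g) T)"
proof -
  define S where "S t = (\<chi> i j. t * g $ i $ j)" for t
  let ?F = "\<lambda>t. f (act m (S t) (mat 1) T)"
  let ?G = "\<lambda>t. f (act m (mat 1) (transpose (S t)) T)"
  have "?F 1 = ?G 1"
  proof (rule polyfun_eqI[where f = ?F and g = ?G and d = "\<lambda>t. det (mat 1 + S t)"])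
    have S: "polyfun (\<lambda>t. S t $ i $ j)" for i j
      unfolding S_def vec_lambda_beta by (intro polyfun_intros)
    show "polyfun ?F"
      by (rule polyfun_act[OF poly]) (rule S, rule polyfun_const)
    show "polyfun ?G"
      by (rule polyfun_act[OF poly]) (rule polyfun_const, simp only: transpose_def vec_lambda_beta S)
    show "polyfun (\<lambda>t. det (mat 1 + S t))"
      by (rule polyfun_det)
        (simp only: vector_add_component vector_minus_component polyfun_add polyfun_diff polyfun_const S)
    have "S 0 = 0" by (simp add: S_def vec_eq_iff)
    then show "det (mat 1 + S 0) \<noteq> 0" by simp
  qed (rule invariant_transfer_generic, assumption)
  moreover have "S 1 = g" by (simp add: S_def vec_eq_iff)
  ultimately show ?thesis by simp
qed

end

section \<open>Multihomogeneous polynomials\<close>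

text \<open>Extensional families, so that each monomial in the K vectors has exactly one
  exponent.\<close>

definition multi_exponents :: "nat \<Rightarrow> (nat \<Rightarrow> nat) \<Rightarrow> (nat \<Rightarrow> ('n::finite \<Rightarrow>\<^sub>0 nat)) set" where
  "multi_exponents K d = PiE {..<K} (\<lambda>k. exponents (d k))"

definition multi_monomial :: "nat \<Rightarrow> (nat \<Rightarrow> ('n::finite \<Rightarrow>\<^sub>0 nat)) \<Rightarrow> (nat \<Rightarrow> complex^'n) \<Rightarrow> complex" where
  "multi_monomial K \<delta> T = (\<Prod>k<K. monomial_value (T k) (\<delta> k))"

definition multihomogeneous :: "nat \<Rightarrow> (nat \<Rightarrow> nat) \<Rightarrow> ((nat \<Rightarrow> complex^'n) \<Rightarrow> complex) \<Rightarrow> bool" where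
  "multihomogeneous K d f \<longleftrightarrow>
     (\<exists>c. \<forall>T. f T = (\<Sum>\<delta>\<in>multi_exponents K d. c \<delta> * multi_monomial K \<delta> T))"

lemma finite_multi_exponents: "finite (multi_exponents K d)"
  unfolding multi_exponents_def by (intro finite_PiE finite_exponents) simp

lemma multi_exponents_cong:
  "(\<And>k. k < K \<Longrightarrow> d k = d' k) \<Longrightarrow> multi_exponents K d = multi_exponents K d'"
  unfolding multi_exponents_def by (intro PiE_cong) simp

lemma multi_exponents_degrees:
  assumes "\<delta> \<in> multi_exponents K d" "\<delta> \<in> multi_exponents K d'" "k < K"
  shows "d k = d' k"
  using assms by (auto simp: multi_exponents_def exponents_def PiE_iff)

lemma polynomial_on_curves_multi_monomial: "polynomial_on_curves (multi_monomial K \<delta>)"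
  unfolding polynomial_on_curves_def multi_monomial_def monomial_value_def
  by (intro allI impI polyfun_prod polyfun_power) simp

lemma multihomogeneous_polynomial_on_curves:
  assumes "multihomogeneous K d f"
  shows "polynomial_on_curves f"
proof -
  obtain c where "f = (\<lambda>T. \<Sum>\<delta>\<in>multi_exponents K d. c \<delta> * multi_monomial K \<delta> T)"
    using assms unfolding multihomogeneous_def by blast
  then show ?thesis
    using polynomial_on_curves_multi_monomial unfolding polynomial_on_curves_def
    by (auto intro!: polyfun_sum polyfun_mult polyfun_const)
qed

lemma multihomogeneous_cong:
  fixes f :: "(nat \<Rightarrow> complex^'n) \<Rightarrow> complex"
  assumes "\<And>k. k < K \<Longrightarrow> d k = d' k" "multihomogeneous K d f"
  shows "multihomogeneous K d' f"
proof -
  have "multi_exponents K d = (multi_exponents K d' :: (nat \<Rightarrow> ('n \<Rightarrow>\<^sub>0 nat)) set)"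
    by (intro multi_exponents_cong assms)
  then show ?thesis
    using assms(2) by (simp only: multihomogeneous_def)
qed

lemma multihomogeneous_monomial:
  assumes "\<delta> \<in> multi_exponents K d"
  shows "multihomogeneous K d (multi_monomial K \<delta>)"
  unfolding multihomogeneous_def
proof (intro exI allI)
  fix T :: "nat \<Rightarrow> complex^'a"
  have "(\<Sum>\<gamma>\<in>multi_exponents K d. (if \<gamma> = \<delta> then 1 else 0) * multi_monomial K \<gamma> T) =
      (\<Sum>\<gamma>\<in>multi_exponents K d. if \<gamma> = \<delta> then multi_monomial K \<delta> T else 0)"
    by (intro sum.cong) auto
  then show "multi_monomial K \<delta> T =
      (\<Sum>\<gamma>\<in>multi_exponents K d. (if \<gamma> = \<delta> then 1 else 0) * multi_monomial K \<gamma> T)"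
    using assms by (simp add: finite_multi_exponents)
qed

lemma multihomogeneous_scale:
  assumes "multihomogeneous K d f"
  shows "multihomogeneous K d (\<lambda>T. a * f T)"
proof -
  obtain c where c: "\<And>T. f T = (\<Sum>\<delta>\<in>multi_exponents K d. c \<delta> * multi_monomial K \<delta> T)"
    using assms unfolding multihomogeneous_def by blast
  show ?thesis
    unfolding multihomogeneous_def
    by (rule exI[of _ "\<lambda>\<delta>. a * c \<delta>"]) (simp add: c sum_distrib_left mult.assoc)
qed

lemma multihomogeneous_sum:
  assumes "\<And>i. i \<in> I \<Longrightarrow> multihomogeneous K d (f i)"
  shows "multihomogeneous K d (\<lambda>T. \<Sum>i\<in>I. f i T)"
proof -
  have "\<forall>i\<in>I. \<exists>c. \<forall>T. f i T = (\<Sum>\<delta>\<in>multi_exponents K d. c \<delta> * multi_monomial K \<delta> T)"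
    using assms unfolding multihomogeneous_def by blast
  from bchoice[OF this] obtain c where c:
    "\<forall>i\<in>I. \<forall>T. f i T = (\<Sum>\<delta>\<in>multi_exponents K d. c i \<delta> * multi_monomial K \<delta> T)" ..
  show ?thesis
    unfolding multihomogeneous_def
  proof (intro exI allI)
    fix T
    have "(\<Sum>i\<in>I. f i T) = (\<Sum>i\<in>I. \<Sum>\<delta>\<in>multi_exponents K d. c i \<delta> * multi_monomial K \<delta> T)"
      using c by (intro sum.cong) auto
    also have "\<dots> = (\<Sum>\<delta>\<in>multi_exponents K d. \<Sum>i\<in>I. c i \<delta> * multi_monomial K \<delta> T)"
      by (rule sum.swap)
    finally show "(\<Sum>i\<in>I. f i T) =
        (\<Sum>\<delta>\<in>multi_exponents K d. (\<Sum>i\<in>I. c i \<delta>) * multi_monomial K \<delta> T)"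
      by (simp add: sum_distrib_right)
  qed
qed

lemma multi_monomial_mult:
  "multi_monomial K \<gamma> T * multi_monomial K \<delta> T =
     multi_monomial K (restrict (\<lambda>k. \<gamma> k + \<delta> k) {..<K}) T"
  by (simp add: multi_monomial_def monomial_value_add prod.distrib)

lemma multihomogeneous_mult:
  assumes f: "multihomogeneous K d f" and g: "multihomogeneous K d' g"
  shows "multihomogeneous K (\<lambda>k. d k + d' k) (\<lambda>T. f T * g T)"
proof -
  obtain b where b: "\<And>T. f T = (\<Sum>\<delta>\<in>multi_exponents K d. b \<delta> * multi_monomial K \<delta> T)"
    using f unfolding multihomogeneous_def by blast
  obtain c where c: "\<And>T. g T = (\<Sum>\<delta>\<in>multi_exponents K d'. c \<delta> * multi_monomial K \<delta> T)"
    using g unfolding multihomogeneous_def by blast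
  have "(\<lambda>T. f T * g T) = (\<lambda>T. \<Sum>\<gamma>\<in>multi_exponents K d. \<Sum>\<delta>\<in>multi_exponents K d'.
      (b \<gamma> * c \<delta>) * multi_monomial K (restrict (\<lambda>k. \<gamma> k + \<delta> k) {..<K}) T)"
    by (simp add: b c sum_product mult_ac flip: multi_monomial_mult)
  moreover have "multihomogeneous K (\<lambda>k. d k + d' k) \<dots>"
    by (intro multihomogeneous_sum multihomogeneous_scale multihomogeneous_monomial)
      (auto simp: multi_exponents_def PiE_iff intro!: exponents_add)
  ultimately show ?thesis by simp
qed

lemma multihomogeneous_1: "multihomogeneous K (\<lambda>_. 0) (\<lambda>_. 1)"
proof -
  have "multihomogeneous K (\<lambda>_. 0) (multi_monomial K (restrict (\<lambda>_. 0) {..<K}))"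
    by (rule multihomogeneous_monomial) (auto simp: multi_exponents_def exponents_def)
  then show ?thesis
    by (simp add: multi_monomial_def[abs_def] monomial_value_def)
qed

lemma multihomogeneous_power:
  assumes "multihomogeneous K d f"
  shows "multihomogeneous K (\<lambda>k. a * d k) (\<lambda>T. f T ^ a)"
proof (induction a)
  case 0
  then show ?case by (simp add: multihomogeneous_1)
next
  case (Suc a)
  then show ?case using multihomogeneous_mult[OF assms Suc] by simp
qed

lemma multihomogeneous_prod:
  assumes "\<And>i. i \<in> I \<Longrightarrow> multihomogeneous K (d i) (f i)"
  shows "multihomogeneous K (\<lambda>k. \<Sum>i\<in>I. d i k) (\<lambda>T. \<Prod>i\<in>I. f i T)"
  using assms
proof (induction I rule: infinite_finite_induct)
  case (insert i I)
  then show ?case using multihomogeneous_mult[of K "d i" "f i"] by simp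
qed (simp_all add: multihomogeneous_1)

text \<open>Bilinear rather than Hermitian: one argument is moved by V and the other by its
  entrywise conjugate, and for unitary V such a pair preserves this form.\<close>

definition dot :: "complex^'n \<Rightarrow> complex^'n \<Rightarrow> complex" where
  "dot x y = (\<Sum>p\<in>UNIV. x $ p * y $ p)"

lemma multihomogeneous_dot:
  assumes "i < K" "k < K" "i \<noteq> k"
  shows "multihomogeneous K (\<lambda>l. if l = i \<or> l = k then 1 else 0) (\<lambda>T. dot (T i) (T k))"
proof -
  \<comment> \<open>The exponent of the monomial \<open>T i $ p * T k $ p\<close>; the pairing is
    the sum of these monomials over p.\<close>
  define \<delta> :: "'a \<Rightarrow> nat \<Rightarrow> ('a \<Rightarrow>\<^sub>0 nat)" where "\<delta> p = restrict (\<lambda>l. if l = i \<or> l = k then Poly_Mapping.single p 1 else 0) {..<K}"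
    for p :: 'a
  have "multi_monomial K (\<delta> p) T = T i $ p * T k $ p" for p and T :: "nat \<Rightarrow> complex^'a"
  proof -
    have "multi_monomial K (\<delta> p) T = (\<Prod>l\<in>{..<K}. if l \<in> {i, k} then T l $ p else 1)"
      unfolding multi_monomial_def \<delta>_def
      by (intro prod.cong) (simp_all add: monomial_value_single, simp add: monomial_value_def)
    also have "\<dots> = (\<Prod>l\<in>{i, k}. T l $ p)"
      using assms by (intro prod.mono_neutral_cong_right) auto
    finally show ?thesis using assms by simp
  qed
  then have "(\<lambda>T. dot (T i) (T k)) = (\<lambda>T. \<Sum>p\<in>UNIV. multi_monomial K (\<delta> p) T)"
    by (simp add: dot_def)
  moreover have "multihomogeneous K (\<lambda>l. if l = i \<or> l = k then 1 else 0) \<dots>"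
  proof (intro multihomogeneous_sum multihomogeneous_monomial)
    fix p :: 'a
    have "\<delta> p l \<in> exponents (if l = i \<or> l = k then 1 else 0)" if "l < K" for l
      using that exponents_single[of p 1] by (simp add: \<delta>_def) (simp add: exponents_def)
    then show "\<delta> p \<in> multi_exponents K (\<lambda>l. if l = i \<or> l = k then 1 else 0)"
      by (auto simp: multi_exponents_def PiE_iff \<delta>_def)
  qed
  ultimately show ?thesis by simp
qed

text \<open>The coefficient functional at \<open>\<gamma>\<close>, defined on all functions as a
  weighted sum of values at finitely many points. The common bound q lets it read polynomials of any
  multidegree up to q, not only those of multidegree d. By the last property it sees only points
  that vanish wherever \<open>\<gamma>\<close> does, and there pairings simplify.\<close>

lemma multi_monomial_dual:
  fixes \<gamma> :: "nat \<Rightarrow> ('n::finite \<Rightarrow>\<^sub>0 nat)"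
  assumes \<gamma>: "\<gamma> \<in> multi_exponents K d" and q: "\<And>k. k < K \<Longrightarrow> d k \<le> q"
  obtains L :: "((nat \<Rightarrow> complex^'n) \<Rightarrow> complex) \<Rightarrow> complex" where
    "\<And>c f I. L (\<lambda>T. \<Sum>i\<in>I. c i * f i T) = (\<Sum>i\<in>I. c i * L (f i))"
    and "\<And>d' \<delta>. \<delta> \<in> multi_exponents K d' \<Longrightarrow> (\<And>k. k < K \<Longrightarrow> d' k \<le> q) \<Longrightarrow>
      L (multi_monomial K \<delta>) = (if \<delta> = \<gamma> then 1 else 0)"
    and "\<And>f g. (\<And>T. (\<And>k p. k < K \<Longrightarrow> Poly_Mapping.lookup (\<gamma> k) p = 0 \<Longrightarrow> T k $ p = 0) \<Longrightarrow>
      f T = g T) \<Longrightarrow> L f = L g"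
proof -
  let ?I = "{..<K} \<times> (UNIV :: 'n set)"
  have bound: "Poly_Mapping.lookup (\<delta> k) p < Suc q"
    if "\<delta> \<in> multi_exponents K d'" "\<And>k. k < K \<Longrightarrow> d' k \<le> q" "k < K"
    for \<delta> :: "nat \<Rightarrow> ('n \<Rightarrow>\<^sub>0 nat)" and d' k p
  proof -
    have "Poly_Mapping.lookup (\<delta> k) p \<le> (\<Sum>p\<in>UNIV. Poly_Mapping.lookup (\<delta> k) p)"
      by (rule member_le_sum) auto
    also have "\<dots> = d' k"
      using that by (auto simp: multi_exponents_def exponents_def PiE_iff)
    finally show ?thesis using that(2,3) by (meson le_imp_less_Suc le_trans)
  qed
  define e where "e i = Poly_Mapping.lookup (\<gamma> (fst i)) (snd i)" for i
  have fin: "finite ?I" by simp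
  have lt: "e i < Suc q" if "i \<in> ?I" for i
    using bound[OF \<gamma> q] that by (auto simp: e_def)
  have "\<exists>X w. finite X \<and> (\<forall>e'. (\<forall>i\<in>?I. e' i < Suc q) \<longrightarrow>
      (\<Sum>x\<in>X. w x * (\<Prod>i\<in>?I. x i ^ e' i)) = (if \<forall>i\<in>?I. e' i = e i then 1 else (0::complex))) \<and>
      (\<forall>x\<in>X. \<forall>i\<in>?I. e i = 0 \<longrightarrow> x i = 0)"
    by (intro monomial_dual_weights fin lt)
  then obtain X w where X: "finite X \<and> (\<forall>e'. (\<forall>i\<in>?I. e' i < Suc q) \<longrightarrow>
      (\<Sum>x\<in>X. w x * (\<Prod>i\<in>?I. x i ^ e' i)) = (if \<forall>i\<in>?I. e' i = e i then 1 else (0::complex))) \<and>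
      (\<forall>x\<in>X. \<forall>i\<in>?I. e i = 0 \<longrightarrow> x i = 0)"
    by (elim exE)
  have dual: "(\<Sum>x\<in>X. w x * (\<Prod>i\<in>?I. x i ^ e' i)) = (if \<forall>i\<in>?I. e' i = e i then 1 else 0)"
    if "\<forall>i\<in>?I. e' i < Suc q" for e'
    using X that by blast
  have zero: "x i = 0" if "x \<in> X" "i \<in> ?I" "e i = 0" for x i
    using X that by blast
  define pt :: "(nat \<times> 'n \<Rightarrow> complex) \<Rightarrow> nat \<Rightarrow> complex^'n" where "pt x k = (\<chi> p. x (k, p))" for x k
  define L where "L f = (\<Sum>x\<in>X. w x * f (pt x))" for f
  show ?thesis
  proof (rule that[of L])
    show "L (\<lambda>T. \<Sum>i\<in>I. c i * f i T) = (\<Sum>i\<in>I. c i * L (f i))" for c and f and I :: "'b set"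
      unfolding L_def sum_distrib_left by (subst sum.swap) (simp add: mult_ac)
  next
    fix d' and \<delta> :: "nat \<Rightarrow> ('n \<Rightarrow>\<^sub>0 nat)"
    assume \<delta>: "\<delta> \<in> multi_exponents K d'" and q': "\<And>k. k < K \<Longrightarrow> d' k \<le> q"
    let ?e = "\<lambda>i. Poly_Mapping.lookup (\<delta> (fst i)) (snd i)"
    have "L (multi_monomial K \<delta>) = (\<Sum>x\<in>X. w x * (\<Prod>i\<in>?I. x i ^ ?e i))"
      by (simp add: L_def multi_monomial_def monomial_value_def pt_def prod.cartesian_product case_prod_beta')
    also have "\<dots> = (if \<forall>i\<in>?I. ?e i = e i then 1 else 0)"
      using bound[OF \<delta> q'] by (intro dual ballI) auto
    also have "(\<forall>i\<in>?I. ?e i = e i) \<longleftrightarrow> \<delta> = \<gamma>"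
    proof
      assume *: "\<forall>i\<in>?I. ?e i = e i"
      show "\<delta> = \<gamma>"
      proof (rule PiE_ext)
        show "\<delta> \<in> PiE {..<K} (\<lambda>_. UNIV)" "\<gamma> \<in> PiE {..<K} (\<lambda>_. UNIV)"
          using \<gamma> \<delta> by (auto simp: multi_exponents_def PiE_iff)
        show "\<delta> k = \<gamma> k" if "k \<in> {..<K}" for k
          using * that by (intro poly_mapping_eqI) (auto simp: e_def)
      qed
    qed (auto simp: e_def)
    finally show "L (multi_monomial K \<delta>) = (if \<delta> = \<gamma> then 1 else 0)" .
  next
    fix f g :: "(nat \<Rightarrow> complex^'n) \<Rightarrow> complex"
    assume *: "\<And>T. (\<And>k p. k < K \<Longrightarrow> Poly_Mapping.lookup (\<gamma> k) p = 0 \<Longrightarrow> T k $ p = 0) \<Longrightarrow> f T = g T"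
    have "f (pt x) = g (pt x)" if "x \<in> X" for x
      using zero[OF that] by (intro *) (auto simp: pt_def e_def)
    then show "L f = L g" unfolding L_def by simp
  qed
qed

section \<open>Invariants are polynomials in the pairings\<close>

lemma dot_vector_matrix: "dot (x v* A) y = dot x (y v* transpose A)"
  unfolding dot_def vector_matrix_mult_def transpose_def
  by (simp add: sum_distrib_left sum_distrib_right, subst sum.swap, simp add: mult_ac)

lemma transpose_matrix_cnj: "transpose (matrix_cnj V) = conj_transpose V"
  by (simp add: transpose_def matrix_cnj_def conj_transpose_def vec_eq_iff)

lemma monomial_value_axis:
  assumes "\<alpha> \<in> exponents j"
  shows "monomial_value (axis r 1) \<alpha> = (if \<alpha> = Poly_Mapping.single r j then 1 else 0)"
proof (cases "\<alpha> = Poly_Mapping.single r j")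
  case True
  then show ?thesis by (simp add: monomial_value_single)
next
  case False
  have "\<exists>p. p \<noteq> r \<and> Poly_Mapping.lookup \<alpha> p \<noteq> 0"
  proof (rule ccontr)
    assume "\<not> ?thesis"
    then have *: "Poly_Mapping.lookup \<alpha> p = 0" if "p \<noteq> r" for p
      using that by auto
    have "j = (\<Sum>p\<in>UNIV. Poly_Mapping.lookup \<alpha> p)"
      using assms by (simp add: exponents_def)
    also have "\<dots> = (\<Sum>p\<in>{r}. Poly_Mapping.lookup \<alpha> p)"
      using * by (intro sum.mono_neutral_right) auto
    finally have "\<alpha> = Poly_Mapping.single r j"
      using * by (intro poly_mapping_eqI) (auto simp: lookup_single when_def)
    with False show False ..
  qed
  then have "monomial_value (axis r 1 :: complex^'a) \<alpha> = 0"
    unfolding monomial_value_def by (auto simp: axis_def)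
  then show ?thesis using False by simp
qed

context
  fixes m K :: nat and \<iota> :: "nat \<Rightarrow> 'n::finite" and d :: "nat \<Rightarrow> nat"
  assumes inj: "inj_on \<iota> {..<m}" and mK: "m \<le> K"
begin

text \<open>The exponents whose monomials can be nonzero at a point where the first m vectors are
  the basis vectors indexed by \<open>\<iota>\<close> and all others lie in their span.\<close>

definition frame_exponents :: "(nat \<Rightarrow> ('n \<Rightarrow>\<^sub>0 nat)) set" where
  "frame_exponents = {\<delta> \<in> multi_exponents K d.
     (\<forall>i<m. \<delta> i = Poly_Mapping.single (\<iota> i) (d i)) \<and>
     (\<forall>k\<in>{m..<K}. \<forall>p. p \<notin> \<iota> ` {..<m} \<longrightarrow> Poly_Mapping.lookup (\<delta> k) p = 0)}"

text \<open>The numbers \<open>Poly_Mapping.lookup (\<delta> k) (\<iota> i)\<close> form a matrix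
  indexed by i and k. The condition prescribes its row sums; its column sums are already forced by
  \<open>frame_exponents\<close>.\<close>

definition balanced_exponents :: "(nat \<Rightarrow> ('n \<Rightarrow>\<^sub>0 nat)) set" where
  "balanced_exponents = {\<delta> \<in> frame_exponents.
     \<forall>i<m. (\<Sum>k\<in>{m..<K}. Poly_Mapping.lookup (\<delta> k) (\<iota> i)) = d i}"

definition pairing_monomial :: "(nat \<Rightarrow> ('n \<Rightarrow>\<^sub>0 nat)) \<Rightarrow> (nat \<Rightarrow> complex^'n) \<Rightarrow> complex" where
  "pairing_monomial \<delta> T =
     (\<Prod>k\<in>{m..<K}. \<Prod>i<m. dot (T i) (T k) ^ Poly_Mapping.lookup (\<delta> k) (\<iota> i))"

lemma monomial_value_frame:
  assumes "\<And>p. p \<notin> \<iota> ` {..<m} \<Longrightarrow> y $ p = 0"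
  shows "monomial_value y \<alpha> = (if \<forall>p. p \<notin> \<iota> ` {..<m} \<longrightarrow> Poly_Mapping.lookup \<alpha> p = 0
    then \<Prod>i<m. (y $ \<iota> i) ^ Poly_Mapping.lookup \<alpha> (\<iota> i) else 0)"
proof (cases "\<forall>p. p \<notin> \<iota> ` {..<m} \<longrightarrow> Poly_Mapping.lookup \<alpha> p = 0")
  case True
  have "monomial_value y \<alpha> = (\<Prod>p\<in>\<iota> ` {..<m}. y $ p ^ Poly_Mapping.lookup \<alpha> p)"
    unfolding monomial_value_def using True by (intro prod.mono_neutral_right) auto
  then show ?thesis using True by (simp add: prod.reindex[OF inj])
next
  case False
  then have "monomial_value y \<alpha> = 0"
    unfolding monomial_value_def using assms by (auto simp: power_0_left)
  then show ?thesis by (simp only: if_not_P[OF False])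
qed

lemma multi_monomial_split:
  "multi_monomial K \<delta> T =
     (\<Prod>i<m. monomial_value (T i) (\<delta> i)) * (\<Prod>k\<in>{m..<K}. monomial_value (T k) (\<delta> k))"
proof -
  have "{..<K} = {..<m} \<union> {m..<K}" using mK by auto
  then show ?thesis
    unfolding multi_monomial_def by (simp add: prod.union_disjoint ivl_disj_int)
qed

text \<open>With $g$ the matrix whose row $\iota(i)$ is $T_i$ and whose other rows vanish, $T$ is the
  frame $e_{\iota(i)}$ moved by $g$; transferring $g$ to the dual vectors leaves only pairings.\<close>

lemma invariant_expansion:
  assumes inv: "unitary_invariant m f"
    and f: "\<And>T. f T = (\<Sum>\<delta>\<in>multi_exponents K d. c \<delta> * multi_monomial K \<delta> T)"
  shows "f T = (\<Sum>\<delta>\<in>frame_exponents. c \<delta> * pairing_monomial \<delta> T)"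
proof -
  have poly: "polynomial_on_curves f"
    using f by (intro multihomogeneous_polynomial_on_curves[of K d])
      (auto simp: multihomogeneous_def)
  define g :: "complex^'n^'n" where
    "g = (\<chi> r. if r \<in> \<iota> ` {..<m} then T (the_inv_into {..<m} \<iota> r) else 0)"
  have row: "g $ \<iota> i = T i" if "i < m" for i
    using that by (simp add: g_def the_inv_into_f_f[OF inj])
  define E where "E k = (if k < m then axis (\<iota> k) 1 else T k)" for k
  have ax: "axis r 1 v* g = g $ r" for r
  proof (rule vec_eq_iff[THEN iffD2], rule allI)
    fix p
    have "(axis r 1 v* g) $ p = (\<Sum>i\<in>UNIV. if i = r then g $ r $ p else 0)"
      unfolding vector_matrix_mult_def vec_lambda_beta
      by (intro sum.cong) (auto simp: axis_def)
    then show "(axis r 1 v* g) $ p = g $ r $ p" by simp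
  qed
  have "act m g (mat 1) E = T"
    by (rule ext) (simp add: act_def E_def ax row)
  moreover define W where "W = act m (mat 1) (transpose g) E"
  ultimately have "f T = f W"
    using invariant_transfer[OF inv poly, of g E] by simp
  have W1: "W i = axis (\<iota> i) 1" if "i < m" for i
    using that by (simp add: W_def act_def E_def)
  \<comment> \<open>Row \<open>\<iota> i\<close> of g is \<open>T i\<close>, so on the frame the
    coordinates of \<open>W k\<close> are the pairings with \<open>T k\<close>; the other rows of g
    vanish.\<close>
  have W2: "W k $ r = (if r \<in> \<iota> ` {..<m} then dot (g $ r) (T k) else 0)" if "k \<in> {m..<K}" for k r
    using that by (auto simp: W_def act_def E_def g_def vector_matrix_mult_def transpose_def dot_def mult.commute)
  \<comment> \<open>At \<open>W\<close> a factor with index below m is 1 for the pure power of its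
    frame variable and 0 otherwise; a later factor is 0 unless its exponent is supported on the
    frame, and then it is a product of powers of pairings.\<close>
  have monomial: "multi_monomial K \<delta> W = (if \<delta> \<in> frame_exponents then pairing_monomial \<delta> T else 0)"
    if \<delta>: "\<delta> \<in> multi_exponents K d" for \<delta>
  proof -
    have "monomial_value (W i) (\<delta> i) = (if \<delta> i = Poly_Mapping.single (\<iota> i) (d i) then 1 else 0)"
      if "i < m" for i
    proof -
      have "\<delta> i \<in> exponents (d i)"
        using \<delta> that mK by (auto simp: multi_exponents_def PiE_iff)
      then show ?thesis
        by (simp only: W1[OF that] monomial_value_axis)
    qed
    then have 1: "(\<Prod>i<m. monomial_value (W i) (\<delta> i)) =
        (\<Prod>i<m. if \<delta> i = Poly_Mapping.single (\<iota> i) (d i) then 1 else 0)"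
      by (intro prod.cong) auto
    have "monomial_value (W k) (\<delta> k) =
        (if \<forall>p. p \<notin> \<iota> ` {..<m} \<longrightarrow> Poly_Mapping.lookup (\<delta> k) p = 0
         then \<Prod>i<m. dot (T i) (T k) ^ Poly_Mapping.lookup (\<delta> k) (\<iota> i) else 0)"
      if "k \<in> {m..<K}" for k
      using that by (subst monomial_value_frame) (auto simp: W2 row intro!: prod.cong)
    then have 2: "(\<Prod>k\<in>{m..<K}. monomial_value (W k) (\<delta> k)) =
        (\<Prod>k\<in>{m..<K}. if \<forall>p. p \<notin> \<iota> ` {..<m} \<longrightarrow> Poly_Mapping.lookup (\<delta> k) p = 0
         then \<Prod>i<m. dot (T i) (T k) ^ Poly_Mapping.lookup (\<delta> k) (\<iota> i) else 0)"
      by (intro prod.cong) auto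
    show ?thesis
    proof (cases "\<delta> \<in> frame_exponents")
      case True
      then show ?thesis
        unfolding multi_monomial_split 1 2 by (simp add: frame_exponents_def pairing_monomial_def)
    next
      case False
      then have "(\<exists>i<m. \<delta> i \<noteq> Poly_Mapping.single (\<iota> i) (d i)) \<or>
          (\<exists>k\<in>{m..<K}. \<not> (\<forall>p. p \<notin> \<iota> ` {..<m} \<longrightarrow> Poly_Mapping.lookup (\<delta> k) p = 0))"
        using \<delta> by (auto simp: frame_exponents_def)
      then have "multi_monomial K \<delta> W = 0"
        unfolding multi_monomial_split 1 2
      proof
        assume "\<exists>i<m. \<delta> i \<noteq> Poly_Mapping.single (\<iota> i) (d i)"
        then have "(\<Prod>i<m. if \<delta> i = Poly_Mapping.single (\<iota> i) (d i) then 1 else 0 :: complex) = 0"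
          by (intro prod_zero) auto
        then show "(\<Prod>i<m. if \<delta> i = Poly_Mapping.single (\<iota> i) (d i) then 1 else 0) *
            (\<Prod>k\<in>{m..<K}. if \<forall>p. p \<notin> \<iota> ` {..<m} \<longrightarrow> Poly_Mapping.lookup (\<delta> k) p = 0
              then \<Prod>i<m. dot (T i) (T k) ^ Poly_Mapping.lookup (\<delta> k) (\<iota> i) else 0) = 0"
          by (simp only: mult_zero_left)
      next
        assume "\<exists>k\<in>{m..<K}. \<not> (\<forall>p. p \<notin> \<iota> ` {..<m} \<longrightarrow> Poly_Mapping.lookup (\<delta> k) p = 0)"
        then obtain k where k: "k \<in> {m..<K}"
            "\<not> (\<forall>p. p \<notin> \<iota> ` {..<m} \<longrightarrow> Poly_Mapping.lookup (\<delta> k) p = 0)"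
          by blast
        have "(\<Prod>k\<in>{m..<K}. if \<forall>p. p \<notin> \<iota> ` {..<m} \<longrightarrow> Poly_Mapping.lookup (\<delta> k) p = 0
              then \<Prod>i<m. dot (T i) (T k) ^ Poly_Mapping.lookup (\<delta> k) (\<iota> i) else 0) = 0"
          by (rule prod_zero) (simp, rule bexI[OF _ k(1)], simp only: if_not_P[OF k(2)])
        then show "(\<Prod>i<m. if \<delta> i = Poly_Mapping.single (\<iota> i) (d i) then 1 else 0) *
            (\<Prod>k\<in>{m..<K}. if \<forall>p. p \<notin> \<iota> ` {..<m} \<longrightarrow> Poly_Mapping.lookup (\<delta> k) p = 0
              then \<Prod>i<m. dot (T i) (T k) ^ Poly_Mapping.lookup (\<delta> k) (\<iota> i) else 0) = 0"
          by (simp only: mult_zero_right)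
      qed
      then show ?thesis using False by simp
    qed
  qed
  note \<open>f T = f W\<close>
  also have "f W = (\<Sum>\<delta>\<in>multi_exponents K d. if \<delta> \<in> frame_exponents then c \<delta> * pairing_monomial \<delta> T else 0)"
    unfolding f[of W] by (intro sum.cong) (simp_all add: monomial)
  also have "\<dots> = (\<Sum>\<delta>\<in>frame_exponents. c \<delta> * pairing_monomial \<delta> T)"
    by (intro sum.mono_neutral_cong_right) (auto simp: finite_multi_exponents frame_exponents_def)
  finally show ?thesis .
qed

text \<open>A pairing feels V only through \<open>matrix_cnj V ** transpose V\<close>, the transpose
  of \<open>V ** conj_transpose V\<close>, which is the identity.\<close>

lemma pairing_monomial_invariant: "unitary_invariant m (pairing_monomial \<delta>)"
  unfolding unitary_invariant_def
proof (intro ballI allI)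
  fix V :: "complex^'n^'n" and T :: "nat \<Rightarrow> complex^'n" assume V: "V \<in> unitary_group"
  have "matrix_cnj V ** transpose V = transpose (V ** conj_transpose V)"
    by (simp add: matrix_transpose_mul flip: transpose_matrix_cnj)
  also have "\<dots> = mat 1"
    using V by (simp add: unitary_group_def)
  finally have eq: "matrix_cnj V ** transpose V = mat 1" .
  have "dot (T i v* V) (T k v* matrix_cnj V) = dot (T i) (T k)" for i k
    unfolding dot_vector_matrix vector_matrix_mul_assoc eq by simp
  then show "pairing_monomial \<delta> (act m V (matrix_cnj V) T) = pairing_monomial \<delta> T"
    unfolding pairing_monomial_def act_def by (intro prod.cong) auto
qed

text \<open>The actual multidegree of a pairing monomial. In the $z_i$ it may differ from d, because
  the expansion above is found by evaluating at \<open>W\<close> and does not sort its terms by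
  degree.\<close>

definition pairing_degree :: "(nat \<Rightarrow> ('n \<Rightarrow>\<^sub>0 nat)) \<Rightarrow> nat \<Rightarrow> nat" where
  "pairing_degree \<delta> l =
     (if l < m then \<Sum>k\<in>{m..<K}. Poly_Mapping.lookup (\<delta> k) (\<iota> l) else d l)"

lemma frame_exponents_sum:
  assumes "\<delta> \<in> frame_exponents" "k \<in> {m..<K}"
  shows "(\<Sum>i<m. Poly_Mapping.lookup (\<delta> k) (\<iota> i)) = d k"
proof -
  have "(\<Sum>i<m. Poly_Mapping.lookup (\<delta> k) (\<iota> i)) = (\<Sum>p\<in>\<iota> ` {..<m}. Poly_Mapping.lookup (\<delta> k) p)"
    by (simp add: sum.reindex[OF inj])
  also have "\<dots> = (\<Sum>p\<in>UNIV. Poly_Mapping.lookup (\<delta> k) p)"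
    using assms by (intro sum.mono_neutral_left) (auto simp: frame_exponents_def)
  also have "\<dots> = d k"
    using assms by (auto simp: frame_exponents_def multi_exponents_def exponents_def PiE_iff)
  finally show ?thesis .
qed

text \<open>Every factor \<open>dot (T i) (T k)\<close> adds one to the degrees in vectors i and k,
  so the degree in a vector is a row or column sum of the exponent matrix.\<close>

lemma pairing_monomial_multihomogeneous:
  assumes "\<delta> \<in> frame_exponents"
  shows "multihomogeneous K (pairing_degree \<delta>) (pairing_monomial \<delta>)"
proof -
  let ?a = "\<lambda>k i. Poly_Mapping.lookup (\<delta> k) (\<iota> i)"
  let ?e = "\<lambda>l. \<Sum>k\<in>{m..<K}. \<Sum>i<m. ?a k i * (if l = i \<or> l = k then 1 else 0)"
  have "multihomogeneous K ?e (pairing_monomial \<delta>)"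
    unfolding pairing_monomial_def[abs_def] using mK
    by (intro multihomogeneous_prod multihomogeneous_power multihomogeneous_dot) auto
  moreover have "?e l = pairing_degree \<delta> l" if "l < K" for l
  proof (cases "l < m")
    case True
    have "?e l = (\<Sum>k\<in>{m..<K}. \<Sum>i<m. if i = l then ?a k i else 0)"
      using True by (intro sum.cong) auto
    then show ?thesis using True by (simp add: pairing_degree_def)
  next
    case False
    have "?e l = (\<Sum>k\<in>{m..<K}. if k = l then \<Sum>i<m. ?a k i else 0)"
      using False by (intro sum.cong) (auto intro!: sum.neutral)
    then show ?thesis
      using False that frame_exponents_sum[OF assms, of l] by (simp add: pairing_degree_def)
  qed
  ultimately show ?thesis by (rule multihomogeneous_cong[rotated])
qed

text \<open>At such points each $z_i$ is a multiple of one basis vector, so a pairing is a product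
  of two coordinates. The coordinates of the $z_i$ collect the row sums, which balance identifies
  with \<open>d i\<close>. As the coefficient functional sees only these points, the coefficient at
  \<open>\<delta>\<close> is 1.\<close>

lemma pairing_monomial_on_support:
  assumes \<delta>: "\<delta> \<in> balanced_exponents"
    and T: "\<And>k p. k < K \<Longrightarrow> Poly_Mapping.lookup (\<delta> k) p = 0 \<Longrightarrow> T k $ p = 0"
  shows "pairing_monomial \<delta> T = multi_monomial K \<delta> T"
proof -
  let ?a = "\<lambda>k i. Poly_Mapping.lookup (\<delta> k) (\<iota> i)"
  have single: "\<delta> i = Poly_Mapping.single (\<iota> i) (d i)" if "i < m" for i
    using \<delta> that by (simp add: balanced_exponents_def frame_exponents_def)
  have sup: "Poly_Mapping.lookup (\<delta> k) p = 0" if "k \<in> {m..<K}" "p \<notin> \<iota> ` {..<m}" for k p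
    using \<delta> that by (simp add: balanced_exponents_def frame_exponents_def)
  have T0: "T i $ p = 0" if "i < m" "p \<noteq> \<iota> i" for i p
    using that mK by (intro T) (auto simp: single lookup_single)
  have dot: "dot (T i) (T k) = T i $ \<iota> i * T k $ \<iota> i" if "i < m" for i k
  proof -
    have "dot (T i) (T k) = (\<Sum>p\<in>{\<iota> i}. T i $ p * T k $ p)"
      unfolding dot_def using T0[OF that] by (intro sum.mono_neutral_right) auto
    then show ?thesis by simp
  qed
  have "pairing_monomial \<delta> T = (\<Prod>k\<in>{m..<K}. \<Prod>i<m. (T i $ \<iota> i) ^ ?a k i * (T k $ \<iota> i) ^ ?a k i)"
    unfolding pairing_monomial_def by (intro prod.cong) (simp_all add: dot power_mult_distrib)
  also have "\<dots> = (\<Prod>k\<in>{m..<K}. \<Prod>i<m. (T i $ \<iota> i) ^ ?a k i) * (\<Prod>k\<in>{m..<K}. \<Prod>i<m. (T k $ \<iota> i) ^ ?a k i)"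
    by (simp add: prod.distrib)
  also have "(\<Prod>k\<in>{m..<K}. \<Prod>i<m. (T i $ \<iota> i) ^ ?a k i) = (\<Prod>i<m. (T i $ \<iota> i) ^ (\<Sum>k\<in>{m..<K}. ?a k i))"
    by (subst prod.swap) (simp add: power_sum)
  also have "\<dots> = (\<Prod>i<m. monomial_value (T i) (\<delta> i))"
    using \<delta> by (intro prod.cong) (simp_all add: balanced_exponents_def single monomial_value_single)
  also have "(\<Prod>k\<in>{m..<K}. \<Prod>i<m. (T k $ \<iota> i) ^ ?a k i) = (\<Prod>k\<in>{m..<K}. monomial_value (T k) (\<delta> k))"
  proof (intro prod.cong refl)
    fix k assume k: "k \<in> {m..<K}"
    have "\<forall>p. p \<notin> \<iota> ` {..<m} \<longrightarrow> Poly_Mapping.lookup (\<delta> k) p = 0" using sup[OF k] by blast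
    moreover have "T k $ p = 0" if "p \<notin> \<iota> ` {..<m}" for p
      using k sup[OF k that] by (intro T) auto
    ultimately show "(\<Prod>i<m. (T k $ \<iota> i) ^ ?a k i) = monomial_value (T k) (\<delta> k)"
      by (simp add: monomial_value_frame)
  qed
  finally show ?thesis by (simp only: multi_monomial_split)
qed

end

section \<open>The trace of the averaging projection\<close>

text \<open>$P$ is the matrix of the averaging projection. Its columns are invariant, so
  $P_{\delta'\gamma} = \sum_\delta P_{\delta\gamma} \, [\delta'] v_\delta$, where $v_\delta$ is the pairing monomial and
  $[\delta']$ the coefficient functional; since $P$ fixes $v_\delta$, the diagonal sums to
  $\sum_\delta [\delta] v_\delta$, and $[\delta] v_\delta = 1$.\<close>

lemma trace_of_averaging:
  fixes P :: "(nat \<Rightarrow> ('n::finite \<Rightarrow>\<^sub>0 nat)) \<Rightarrow> (nat \<Rightarrow> ('n \<Rightarrow>\<^sub>0 nat)) \<Rightarrow> complex"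
    and \<iota> :: "nat \<Rightarrow> 'n"
  assumes inj: "inj_on \<iota> {..<m}" and mK: "m \<le> K"
    and inv: "\<And>\<gamma>. \<gamma> \<in> multi_exponents K d \<Longrightarrow>
      unitary_invariant m (\<lambda>T. \<Sum>\<delta>\<in>multi_exponents K d. P \<delta> \<gamma> * multi_monomial K \<delta> T)"
    and fixed: "\<And>r T. unitary_invariant m (\<lambda>T. \<Sum>\<gamma>\<in>multi_exponents K d. r \<gamma> * multi_monomial K \<gamma> T) \<Longrightarrow>
      (\<Sum>\<gamma>\<in>multi_exponents K d. r \<gamma> * (\<Sum>\<delta>\<in>multi_exponents K d. P \<delta> \<gamma> * multi_monomial K \<delta> T)) =
      (\<Sum>\<gamma>\<in>multi_exponents K d. r \<gamma> * multi_monomial K \<gamma> T)"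
  shows "(\<Sum>\<gamma>\<in>multi_exponents K d. P \<gamma> \<gamma>) = of_nat (card (balanced_exponents m K \<iota> d))"
proof -
  let ?\<Gamma> = "multi_exponents K d :: (nat \<Rightarrow> ('n \<Rightarrow>\<^sub>0 nat)) set"
  let ?e = "multi_monomial K"
  let ?v = "pairing_monomial m K \<iota>"
  let ?F = "frame_exponents m K \<iota> d"
  let ?B = "balanced_exponents m K \<iota> d"
  define g where "g \<gamma> T = (\<Sum>\<delta>\<in>?\<Gamma>. P \<delta> \<gamma> * ?e \<delta> T)" for \<gamma> T
  have F\<Gamma>: "?F \<subseteq> ?\<Gamma>" and BF: "?B \<subseteq> ?F"
    by (auto simp: frame_exponents_def[OF inj mK] balanced_exponents_def[OF inj mK])
  have fin: "finite ?F" "finite ?B"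
    using finite_subset[OF F\<Gamma> finite_multi_exponents] finite_subset[OF BF] by auto
  \<comment> \<open>Large enough for d and for the degrees of all pairing monomials, unbalanced ones
    included, so that the same functionals apply to all of them.\<close>
  define q where "q = (\<Sum>k<K. d k) + (\<Sum>\<delta>\<in>?F. \<Sum>k<K. pairing_degree m K \<iota> d \<delta> k)"
  have q1: "d k \<le> q" if "k < K" for k
    using that member_le_sum[of k "{..<K}" d] by (simp add: q_def)
  have q2: "pairing_degree m K \<iota> d \<delta> k \<le> q" if "\<delta> \<in> ?F" "k < K" for \<delta> k
  proof -
    have "pairing_degree m K \<iota> d \<delta> k \<le> (\<Sum>k<K. pairing_degree m K \<iota> d \<delta> k)"
      using that by (intro member_le_sum) auto
    also have "\<dots> \<le> (\<Sum>\<delta>\<in>?F. \<Sum>k<K. pairing_degree m K \<iota> d \<delta> k)"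
      using that fin by (intro member_le_sum[of \<delta> ?F "\<lambda>\<delta>. \<Sum>k<K. pairing_degree m K \<iota> d \<delta> k"]) auto
    finally show ?thesis by (simp add: q_def)
  qed
  \<comment> \<open>Bundles the three properties so that one functional can be chosen for each
    \<open>\<gamma>\<close>; the index type of the sums is fixed because a formula cannot quantify
    over types.\<close>
  define dual where "dual \<gamma> L \<longleftrightarrow>
      (\<forall>c f (I :: (nat \<Rightarrow> ('n \<Rightarrow>\<^sub>0 nat)) set). L (\<lambda>T. \<Sum>i\<in>I. c i * f i T) = (\<Sum>i\<in>I. c i * L (f i))) \<and>
      (\<forall>d' \<delta>. \<delta> \<in> multi_exponents K d' \<longrightarrow> (\<forall>k<K. d' k \<le> q) \<longrightarrow> L (?e \<delta>) = (if \<delta> = \<gamma> then 1 else 0)) \<and>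
      (\<forall>f g. (\<forall>T. (\<forall>k p. k < K \<longrightarrow> Poly_Mapping.lookup (\<gamma> k) p = 0 \<longrightarrow> T k $ p = 0) \<longrightarrow> f T = g T) \<longrightarrow> L f = L g)"
    for \<gamma> and L :: "((nat \<Rightarrow> complex^'n) \<Rightarrow> complex) \<Rightarrow> complex"
  have "\<forall>\<gamma>\<in>?\<Gamma>. \<exists>L. dual \<gamma> L"
  proof
    fix \<gamma> assume \<gamma>: "\<gamma> \<in> ?\<Gamma>"
    show "\<exists>L. dual \<gamma> L"
    proof (rule multi_monomial_dual[OF \<gamma> q1])
      fix L :: "((nat \<Rightarrow> complex^'n) \<Rightarrow> complex) \<Rightarrow> complex"
      assume 1: "\<And>c f (I :: (nat \<Rightarrow> ('n \<Rightarrow>\<^sub>0 nat)) set). L (\<lambda>T. \<Sum>i\<in>I. c i * f i T) = (\<Sum>i\<in>I. c i * L (f i))"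
        and 2: "\<And>d' \<delta>. \<delta> \<in> multi_exponents K d' \<Longrightarrow> (\<And>k. k < K \<Longrightarrow> d' k \<le> q) \<Longrightarrow>
          L (multi_monomial K \<delta>) = (if \<delta> = \<gamma> then 1 else 0)"
        and 3: "\<And>f g. (\<And>T. (\<And>k p. k < K \<Longrightarrow> Poly_Mapping.lookup (\<gamma> k) p = 0 \<Longrightarrow> T k $ p = 0) \<Longrightarrow>
          f T = g T) \<Longrightarrow> L f = L g"
      have "dual \<gamma> L"
        unfolding dual_def
      proof (intro conjI allI impI)
        show "L (\<lambda>T. \<Sum>i\<in>I. c i * f i T) = (\<Sum>i\<in>I. c i * L (f i))"
          for c f and I :: "(nat \<Rightarrow> ('n \<Rightarrow>\<^sub>0 nat)) set"
          by (rule 1)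
        show "L (?e \<delta>) = (if \<delta> = \<gamma> then 1 else 0)"
          if "\<delta> \<in> multi_exponents K d'" "\<forall>k<K. d' k \<le> q" for d' \<delta>
          using that by (intro 2[of \<delta> d']) auto
        show "L f = L g" if "\<forall>T. (\<forall>k p. k < K \<longrightarrow> Poly_Mapping.lookup (\<gamma> k) p = 0 \<longrightarrow> T k $ p = 0) \<longrightarrow> f T = g T"
          for f g
          using that by (intro 3) auto
      qed
      then show ?thesis by (rule exI[of "dual \<gamma>" L])
    qed
  qed
  from bchoice[OF this] obtain L where L: "\<forall>\<gamma>\<in>?\<Gamma>. dual \<gamma> (L \<gamma>)" ..
  have lin: "L \<gamma> (\<lambda>T. \<Sum>i\<in>I. c i * f i T) = (\<Sum>i\<in>I. c i * L \<gamma> (f i))"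
    if "\<gamma> \<in> ?\<Gamma>" for \<gamma> c f and I :: "(nat \<Rightarrow> ('n \<Rightarrow>\<^sub>0 nat)) set"
    using L that unfolding dual_def by blast
  have Le: "L \<gamma> (?e \<delta>) = (if \<delta> = \<gamma> then 1 else 0)"
    if "\<gamma> \<in> ?\<Gamma>" "\<delta> \<in> multi_exponents K d'" "\<And>k. k < K \<Longrightarrow> d' k \<le> q" for \<gamma> d' \<delta>
    using L that unfolding dual_def by blast
  have Lcong: "L \<gamma> f = L \<gamma> h" if "\<gamma> \<in> ?\<Gamma>"
    "\<And>T. (\<And>k p. k < K \<Longrightarrow> Poly_Mapping.lookup (\<gamma> k) p = 0 \<Longrightarrow> T k $ p = 0) \<Longrightarrow> f T = h T" for \<gamma> f h
    using L[rule_format, OF that(1), unfolded dual_def] that(2) by blast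
  have coefficient: "L \<gamma> (\<lambda>T. \<Sum>\<delta>\<in>multi_exponents K d'. c \<delta> * ?e \<delta> T) =
      (if \<gamma> \<in> multi_exponents K d' then c \<gamma> else 0)"
    if "\<gamma> \<in> ?\<Gamma>" "\<And>k. k < K \<Longrightarrow> d' k \<le> q" for \<gamma> d' c
  proof -
    have "L \<gamma> (\<lambda>T. \<Sum>\<delta>\<in>multi_exponents K d'. c \<delta> * ?e \<delta> T) =
        (\<Sum>\<delta>\<in>multi_exponents K d'. c \<delta> * (if \<delta> = \<gamma> then 1 else 0))"
      unfolding lin[OF that(1)] by (intro sum.cong refl) (simp only: Le[OF that(1) _ that(2)])
    also have "\<dots> = (\<Sum>\<delta>\<in>multi_exponents K d'. if \<delta> = \<gamma> then c \<gamma> else 0)"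
      by (intro sum.cong) auto
    also have "\<dots> = (if \<gamma> \<in> multi_exponents K d' then c \<gamma> else 0)"
      by (simp add: finite_multi_exponents)
    finally show ?thesis .
  qed
  have gP: "L \<gamma>' (g \<gamma>) = P \<gamma>' \<gamma>" if "\<gamma>' \<in> ?\<Gamma>" for \<gamma> \<gamma>'
    unfolding g_def[abs_def] using coefficient[OF that q1] that by simp
  \<comment> \<open>The coefficients are again entries of P: passing from monomials to pairing
    monomials leaves them unchanged.\<close>
  have g_expansion: "g \<gamma> = (\<lambda>T. \<Sum>\<delta>\<in>?F. P \<delta> \<gamma> * ?v \<delta> T)" if "\<gamma> \<in> ?\<Gamma>" for \<gamma>
    unfolding g_def[abs_def] by (rule ext) (rule invariant_expansion[OF inj mK inv[OF that] refl])
  \<comment> \<open>An unbalanced pairing monomial has the wrong degree in some $z_i$, so no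
    monomial of multidegree d occurs in it.\<close>
  have unbalanced: "L \<gamma> (?v \<delta>) = 0" if \<gamma>: "\<gamma> \<in> ?\<Gamma>" and \<delta>: "\<delta> \<in> ?F" "\<delta> \<notin> ?B" for \<gamma> \<delta>
  proof -
    obtain c where c: "?v \<delta> = (\<lambda>T. \<Sum>\<delta>'\<in>multi_exponents K (pairing_degree m K \<iota> d \<delta>). c \<delta>' * ?e \<delta>' T)"
      using pairing_monomial_multihomogeneous[OF inj mK \<delta>(1)] unfolding multihomogeneous_def by blast
    have "\<gamma> \<notin> multi_exponents K (pairing_degree m K \<iota> d \<delta>)"
    proof
      assume "\<gamma> \<in> multi_exponents K (pairing_degree m K \<iota> d \<delta>)"
      then have degree: "pairing_degree m K \<iota> d \<delta> k = d k" if "k < K" for k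
        using multi_exponents_degrees[OF _ \<gamma> that] by blast
      have "(\<Sum>k\<in>{m..<K}. Poly_Mapping.lookup (\<delta> k) (\<iota> i)) = d i" if "i < m" for i
        using that mK degree[of i] by (simp add: pairing_degree_def[OF inj mK])
      then show False
        using \<delta> by (simp add: balanced_exponents_def[OF inj mK])
    qed
    then show ?thesis
      unfolding c using coefficient[OF \<gamma> q2[OF \<delta>(1)]] by simp
  qed
  \<comment> \<open>Averaging fixes the pairing monomial. Comparing the coefficients at
    \<open>\<delta>\<close> before and after gives this sum on one side and 1 on the other.\<close>
  have balanced: "(\<Sum>\<gamma>\<in>?\<Gamma>. P \<delta> \<gamma> * L \<gamma> (?v \<delta>)) = 1" if \<delta>: "\<delta> \<in> ?B" for \<delta>
  proof -
    have \<delta>F: "\<delta> \<in> ?F" and \<delta>\<Gamma>: "\<delta> \<in> ?\<Gamma>" using \<delta> BF F\<Gamma> by auto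
    have "pairing_degree m K \<iota> d \<delta> k = d k" for k
      using \<delta> by (simp add: pairing_degree_def[OF inj mK] balanced_exponents_def[OF inj mK])
    then have "pairing_degree m K \<iota> d \<delta> = d" by (rule ext)
    then have "multihomogeneous K d (?v \<delta>)"
      using pairing_monomial_multihomogeneous[OF inj mK \<delta>F] by simp
    then obtain r where r: "?v \<delta> = (\<lambda>T. \<Sum>\<gamma>\<in>?\<Gamma>. r \<gamma> * ?e \<gamma> T)"
      unfolding multihomogeneous_def by blast
    have Lr: "L \<gamma> (?v \<delta>) = r \<gamma>" if "\<gamma> \<in> ?\<Gamma>" for \<gamma>
      unfolding r using coefficient[OF that q1] that by simp
    have "unitary_invariant m (?v \<delta>)"
      by (rule pairing_monomial_invariant[OF inj mK])
    then have "(\<lambda>T. \<Sum>\<gamma>\<in>?\<Gamma>. r \<gamma> * g \<gamma> T) = ?v \<delta>"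
      unfolding r g_def by (intro ext fixed)
    then have "L \<delta> (?v \<delta>) = L \<delta> (\<lambda>T. \<Sum>\<gamma>\<in>?\<Gamma>. r \<gamma> * g \<gamma> T)"
      by simp
    also have "\<dots> = (\<Sum>\<gamma>\<in>?\<Gamma>. r \<gamma> * L \<delta> (g \<gamma>))"
      by (rule lin[OF \<delta>\<Gamma>])
    also have "\<dots> = (\<Sum>\<gamma>\<in>?\<Gamma>. P \<delta> \<gamma> * L \<gamma> (?v \<delta>))"
      by (intro sum.cong refl) (simp add: gP[OF \<delta>\<Gamma>] Lr mult.commute)
    also have "L \<delta> (?v \<delta>) = L \<delta> (?e \<delta>)"
      by (intro Lcong \<delta>\<Gamma> pairing_monomial_on_support[OF inj mK \<delta>])
    also have "L \<delta> (?e \<delta>) = 1"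
      using Le[OF \<delta>\<Gamma> \<delta>\<Gamma> q1] by simp
    finally show ?thesis by simp
  qed
  have "(\<Sum>\<gamma>\<in>?\<Gamma>. P \<gamma> \<gamma>) = (\<Sum>\<gamma>\<in>?\<Gamma>. \<Sum>\<delta>\<in>?B. P \<delta> \<gamma> * L \<gamma> (?v \<delta>))"
  proof (intro sum.cong refl)
    fix \<gamma> assume \<gamma>: "\<gamma> \<in> ?\<Gamma>"
    have "P \<gamma> \<gamma> = (\<Sum>\<delta>\<in>?F. P \<delta> \<gamma> * L \<gamma> (?v \<delta>))"
      unfolding gP[OF \<gamma>, symmetric] g_expansion[OF \<gamma>] lin[OF \<gamma>] by (simp add: gP[OF \<gamma>])
    also have "\<dots> = (\<Sum>\<delta>\<in>?B. P \<delta> \<gamma> * L \<gamma> (?v \<delta>))"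
      using BF fin unbalanced[OF \<gamma>] by (intro sum.mono_neutral_right) auto
    finally show "P \<gamma> \<gamma> = (\<Sum>\<delta>\<in>?B. P \<delta> \<gamma> * L \<gamma> (?v \<delta>))" .
  qed
  also have "\<dots> = (\<Sum>\<delta>\<in>?B. \<Sum>\<gamma>\<in>?\<Gamma>. P \<delta> \<gamma> * L \<gamma> (?v \<delta>))"
    by (rule sum.swap)
  also have "\<dots> = (\<Sum>\<delta>\<in>?B. 1)"
    by (intro sum.cong refl balanced)
  finally show ?thesis by simp
qed

section \<open>Averaging over the unitary group\<close>

definition vec_cnj :: "complex^'n \<Rightarrow> complex^'n" where
  "vec_cnj x = (\<chi> p. cnj (x $ p))"

lemma vec_cnj_vector_matrix: "vec_cnj x v* matrix_cnj U = vec_cnj (x v* U)"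
  by (simp add: vec_cnj_def matrix_cnj_def vector_matrix_mult_def vec_eq_iff)

lemma vec_cnj_vec_cnj: "vec_cnj (vec_cnj x) = x"
  by (simp add: vec_cnj_def vec_eq_iff)

lemma monomial_value_cnj: "monomial_value (vec_cnj x) \<alpha> = cnj (monomial_value x \<alpha>)"
  by (simp add: monomial_value_def vec_cnj_def)

text \<open>Acting by the conjugate of U on x is acting by U on the conjugate of x and conjugating
  the result.\<close>

lemma monomial_value_vector_matrix_cnj:
  assumes "\<alpha> \<in> exponents j"
  shows "monomial_value (x v* matrix_cnj U) \<alpha> =
    (\<Sum>\<beta>\<in>exponents j. cnj (sym_entry U \<beta> \<alpha>) * monomial_value x \<beta>)"
proof -
  have "x v* matrix_cnj U = vec_cnj (vec_cnj x v* U)"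
    by (simp add: vec_cnj_vec_cnj flip: vec_cnj_vector_matrix)
  then show ?thesis
    by (simp add: monomial_value_cnj monomial_value_vector_matrix[OF assms])
qed

text \<open>\<open>sym_entry\<close> is a coefficient of a formal product, which hides how it
  depends on U. Extracting it by weights gives a finite combination of monomials in
  \<open>x v* U\<close>, and these are visibly continuous in U.\<close>

lemma continuous_on_sym_entry:
  assumes "\<alpha> \<in> exponents j" "\<beta> \<in> exponents j"
  shows "continuous_on UNIV (\<lambda>U :: complex^'n^'n. sym_entry U \<beta> \<alpha>)"
proof -
  have bound: "Poly_Mapping.lookup \<gamma> p < Suc j" if "\<gamma> \<in> exponents j" for \<gamma> :: "'n \<Rightarrow>\<^sub>0 nat" and p
    using that member_le_sum[of p UNIV "Poly_Mapping.lookup \<gamma>"] by (simp add: exponents_def)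
  have "\<exists>X w. finite X \<and> (\<forall>e. (\<forall>i\<in>UNIV. e i < Suc j) \<longrightarrow>
      (\<Sum>x\<in>X. w x * (\<Prod>i\<in>UNIV. x i ^ e i)) = (if \<forall>i\<in>UNIV. e i = Poly_Mapping.lookup \<beta> i then 1 else (0::complex))) \<and>
      (\<forall>x\<in>X. \<forall>i\<in>UNIV. Poly_Mapping.lookup \<beta> i = 0 \<longrightarrow> x i = 0)"
    by (intro monomial_dual_weights bound assms) simp
  then obtain X w where X: "\<And>e. (\<forall>i. e i < Suc j) \<Longrightarrow>
      (\<Sum>x\<in>X. w x * (\<Prod>i\<in>UNIV. x i ^ e i)) = (if \<forall>i. e i = Poly_Mapping.lookup \<beta> i then 1 else (0::complex))"
    by auto
  have "sym_entry U \<beta> \<alpha> = (\<Sum>x\<in>X. w x * monomial_value ((\<chi> p. x p) v* U) \<alpha>)" for U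
  proof -
    have "(\<Sum>x\<in>X. w x * monomial_value ((\<chi> p. x p) v* U) \<alpha>) =
        (\<Sum>x\<in>X. \<Sum>\<gamma>\<in>exponents j. w x * (sym_entry U \<gamma> \<alpha> * monomial_value (\<chi> p. x p) \<gamma>))"
      by (simp add: monomial_value_vector_matrix[OF assms(1)] sum_distrib_left)
    also have "\<dots> = (\<Sum>\<gamma>\<in>exponents j. \<Sum>x\<in>X. w x * (sym_entry U \<gamma> \<alpha> * monomial_value (\<chi> p. x p) \<gamma>))"
      by (rule sum.swap)
    also have "\<dots> = (\<Sum>\<gamma>\<in>exponents j. sym_entry U \<gamma> \<alpha> * (\<Sum>x\<in>X. w x * (\<Prod>i\<in>UNIV. x i ^ Poly_Mapping.lookup \<gamma> i)))"
      by (simp add: monomial_value_def sum_distrib_left mult_ac)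
    also have "\<dots> = (\<Sum>\<gamma>\<in>exponents j. if \<gamma> = \<beta> then sym_entry U \<beta> \<alpha> else 0)"
    proof (intro sum.cong refl)
      fix \<gamma> :: "'n \<Rightarrow>\<^sub>0 nat" assume "\<gamma> \<in> exponents j"
      then have "(\<Sum>x\<in>X. w x * (\<Prod>i\<in>UNIV. x i ^ Poly_Mapping.lookup \<gamma> i)) = (if \<gamma> = \<beta> then 1 else 0)"
        using bound[of \<gamma>] by (subst X) (auto simp: poly_mapping_eq_iff fun_eq_iff)
      then show "sym_entry U \<gamma> \<alpha> * (\<Sum>x\<in>X. w x * (\<Prod>i\<in>UNIV. x i ^ Poly_Mapping.lookup \<gamma> i)) =
          (if \<gamma> = \<beta> then sym_entry U \<beta> \<alpha> else 0)"
        by simp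
    qed
    also have "\<dots> = sym_entry U \<beta> \<alpha>"
      using assms(2) by (simp add: finite_exponents)
    finally show ?thesis by simp
  qed
  then show ?thesis
    unfolding monomial_value_def vector_matrix_mult_def
    by (simp only: vec_lambda_beta) (intro continuous_intros)
qed

text \<open>The matrix, in the monomial basis, of the tensor product of symmetric powers of U
  (indices below m) and of its conjugate (the others).\<close>

definition entry_product ::
  "nat \<Rightarrow> nat \<Rightarrow> complex^'n^'n \<Rightarrow> (nat \<Rightarrow> ('n \<Rightarrow>\<^sub>0 nat)) \<Rightarrow> (nat \<Rightarrow> ('n \<Rightarrow>\<^sub>0 nat)) \<Rightarrow> complex" where
  "entry_product m K U \<delta> \<gamma> = (\<Prod>k<K.
     if k < m then sym_entry U (\<delta> k) (\<gamma> k) else cnj (sym_entry U (\<delta> k) (\<gamma> k)))"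

lemma multi_monomial_act:
  assumes "\<gamma> \<in> multi_exponents K d"
  shows "multi_monomial K \<gamma> (act m U (matrix_cnj U) T) =
    (\<Sum>\<delta>\<in>multi_exponents K d. entry_product m K U \<delta> \<gamma> * multi_monomial K \<delta> T)"
proof -
  have "multi_monomial K \<gamma> (act m U (matrix_cnj U) T) = (\<Prod>k<K. \<Sum>\<beta>\<in>exponents (d k).
      (if k < m then sym_entry U \<beta> (\<gamma> k) else cnj (sym_entry U \<beta> (\<gamma> k))) * monomial_value (T k) \<beta>)"
    unfolding multi_monomial_def
  proof (intro prod.cong refl)
    fix k assume "k \<in> {..<K}"
    then have \<gamma>: "\<gamma> k \<in> exponents (d k)"
      using assms by (auto simp: multi_exponents_def PiE_iff)
    show "monomial_value (act m U (matrix_cnj U) T k) (\<gamma> k) = (\<Sum>\<beta>\<in>exponents (d k).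
        (if k < m then sym_entry U \<beta> (\<gamma> k) else cnj (sym_entry U \<beta> (\<gamma> k))) * monomial_value (T k) \<beta>)"
      using monomial_value_vector_matrix[OF \<gamma>, of "T k" U]
        monomial_value_vector_matrix_cnj[OF \<gamma>, of "T k" U] by (simp add: act_def)
  qed
  also have "\<dots> = (\<Sum>\<delta>\<in>multi_exponents K d. \<Prod>k<K.
      (if k < m then sym_entry U (\<delta> k) (\<gamma> k) else cnj (sym_entry U (\<delta> k) (\<gamma> k))) * monomial_value (T k) (\<delta> k))"
    unfolding multi_exponents_def by (intro prod_sum_PiE finite_exponents) simp
  finally show ?thesis
    by (simp add: prod.distrib entry_product_def multi_monomial_def)
qed

text \<open>The trace of a tensor product is the product of the traces.\<close>

lemma entry_product_trace:
  "(\<Sum>\<gamma>\<in>multi_exponents K d. entry_product m K U \<gamma> \<gamma>) =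
     (\<Prod>k<K. if k < m then trace_sym (d k) U else cnj (trace_sym (d k) U))"
proof -
  have "(\<Prod>k<K. if k < m then trace_sym (d k) U else cnj (trace_sym (d k) U)) =
      (\<Prod>k<K. \<Sum>\<alpha>\<in>exponents (d k). if k < m then sym_entry U \<alpha> \<alpha> else cnj (sym_entry U \<alpha> \<alpha>))"
    by (intro prod.cong) (auto simp: trace_sym_def)
  also have "\<dots> = (\<Sum>\<gamma>\<in>multi_exponents K d. entry_product m K U \<gamma> \<gamma>)"
    unfolding multi_exponents_def entry_product_def by (intro prod_sum_PiE finite_exponents) simp
  finally show ?thesis by simp
qed

lemma continuous_on_entry_product:
  assumes "\<delta> \<in> multi_exponents K d" "\<gamma> \<in> multi_exponents K d"
  shows "continuous_on UNIV (\<lambda>U :: complex^'n^'n. entry_product m K U \<delta> \<gamma>)"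
  unfolding entry_product_def
proof (intro continuous_on_prod)
  fix k assume "k \<in> {..<K}"
  then have "continuous_on UNIV (\<lambda>U :: complex^'n^'n. sym_entry U (\<delta> k) (\<gamma> k))"
    using assms by (intro continuous_on_sym_entry[of _ "d k"]) (auto simp: multi_exponents_def PiE_iff)
  then show "continuous_on UNIV (\<lambda>U :: complex^'n^'n.
      if k < m then sym_entry U (\<delta> k) (\<gamma> k) else cnj (sym_entry U (\<delta> k) (\<gamma> k)))"
    by (cases "k < m") (simp_all add: continuous_on_cnj)
qed

section \<open>Compactness of the unitary group and integration over it\<close>

lemma compact_unitary_group: "compact (unitary_group :: (complex^'n^'n) set)"
  unfolding compact_eq_bounded_closed
proof
  have "norm U \<le> (\<Sum>i\<in>(UNIV :: 'n set). 1)" if "U \<in> unitary_group" for U :: "complex^'n^'n"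
  proof -
    \<comment> \<open>The rows of a unitary matrix are unit vectors: the diagonal entries of
      \<open>U ** conj_transpose U\<close> are their squared norms.\<close>
    have "norm (U $ i) \<le> 1" for i
    proof -
      have "(\<Sum>j\<in>UNIV. U $ i $ j * cnj (U $ i $ j)) = (U ** conj_transpose U) $ i $ i"
        by (simp add: matrix_matrix_mult_def conj_transpose_def)
      also have "\<dots> = 1"
        using that by (simp add: unitary_group_def mat_def)
      finally have "complex_of_real (\<Sum>j\<in>UNIV. (norm (U $ i $ j))\<^sup>2) = 1"
        by (simp only: of_real_sum complex_norm_square)
      then have "(\<Sum>j\<in>UNIV. (norm (U $ i $ j))\<^sup>2) = 1"
        using of_real_eq_1_iff by blast
      then show ?thesis
        by (simp add: norm_vec_def L2_set_def)
    qed
    then have "(\<Sum>i\<in>UNIV. norm (U $ i)) \<le> (\<Sum>i\<in>(UNIV :: 'n set). 1)"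
      by (rule sum_mono)
    moreover have "norm U \<le> (\<Sum>i\<in>UNIV. norm (U $ i))"
      unfolding norm_vec_def by (rule L2_set_le_sum) simp
    ultimately show ?thesis by linarith
  qed
  then show "bounded (unitary_group :: (complex^'n^'n) set)"
    unfolding bounded_iff by blast
  have "unitary_group = {U :: complex^'n^'n. \<forall>i j. (\<Sum>k\<in>UNIV. cnj (U $ k $ i) * U $ k $ j) = mat 1 $ i $ j \<and>
      (\<Sum>k\<in>UNIV. U $ i $ k * cnj (U $ j $ k)) = mat 1 $ i $ j}"
    by (auto simp: unitary_group_def matrix_matrix_mult_def conj_transpose_def vec_eq_iff)
  moreover have "closed \<dots>"
    by (intro closed_Collect_all closed_Collect_conj closed_Collect_eq continuous_intros)
  ultimately show "closed (unitary_group :: (complex^'n^'n) set)" by simp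
qed

lemma unitary_group_mult:
  assumes "V \<in> unitary_group" "U \<in> unitary_group"
  shows "V ** U \<in> unitary_group"
proof (rule unitary_groupI)
  have "V ** U ** conj_transpose (V ** U) = V ** (U ** conj_transpose U) ** conj_transpose V"
    by (simp add: conj_transpose_mult matrix_mul_assoc)
  then show "V ** U ** conj_transpose (V ** U) = mat 1"
    using assms by (simp add: unitary_group_def)
qed

context
  fixes M :: "(complex^'n^'n) measure"
  assumes haar: "haar_prob_measure M"
begin

lemma haar_sets: "sets M = sets (restrict_space borel unitary_group)"
  using haar by (simp add: haar_prob_measure_def)

lemma haar_space: "space M = unitary_group"
  using sets_eq_imp_space_eq[OF haar_sets] by (simp add: space_restrict_space)

lemma haar_measurable:
  assumes "continuous_on UNIV (f :: complex^'n^'n \<Rightarrow> 'b::topological_space)"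
  shows "f \<in> borel_measurable M"
proof -
  have "f \<in> borel_measurable (restrict_space borel unitary_group)"
    using assms by (intro measurable_restrict_space1 borel_measurable_continuous_onI)
  then show ?thesis
    by (simp only: measurable_cong_sets[OF haar_sets refl])
qed

lemma haar_integrable:
  assumes "continuous_on UNIV (f :: complex^'n^'n \<Rightarrow> complex)"
  shows "integrable M f"
proof -
  interpret prob_space M
    using haar by (simp add: haar_prob_measure_def)
  have "compact (f ` unitary_group)"
    by (intro compact_continuous_image compact_unitary_group continuous_on_subset[OF assms subset_UNIV])
  then obtain B where "\<And>U. U \<in> unitary_group \<Longrightarrow> norm (f U) \<le> B"
    using compact_imp_bounded[of "f ` unitary_group"] unfolding bounded_iff by blast
  then show ?thesis
    by (intro integrable_const_bound[of _ B] haar_measurable assms) (auto simp: haar_space intro!: AE_I2)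
qed

lemma haar_translate:
  assumes V: "V \<in> unitary_group" and f: "continuous_on UNIV (f :: complex^'n^'n \<Rightarrow> complex)"
  shows "(LINT U|M. f (V ** U)) = (LINT U|M. f U)"
proof -
  have "continuous_on UNIV (\<lambda>U. V ** U)"
    unfolding matrix_matrix_mult_def by (intro continuous_intros)
  then have "(\<lambda>U. V ** U) \<in> borel_measurable M"
    by (rule haar_measurable)
  then have "(\<lambda>U. V ** U) \<in> measurable M (restrict_space borel unitary_group)"
    by (intro measurable_restrict_space2) (auto simp: haar_space intro: unitary_group_mult V)
  then have "(\<lambda>U. V ** U) \<in> measurable M M"
    by (simp only: measurable_cong_sets[OF refl haar_sets])
  then have "(LINT U|distr M M (\<lambda>U. V ** U). f U) = (LINT U|M. f (V ** U))"
    by (rule integral_distr) (rule haar_measurable[OF f])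
  moreover have "distr M M (\<lambda>U. V ** U) = M"
    using haar V by (simp add: haar_prob_measure_def)
  ultimately show ?thesis by simp
qed

text \<open>Integrating the action entrywise gives the averaging matrix. Left invariance makes its
  columns invariant, total mass 1 makes it fix invariants, and its trace is the integral of the
  trace.\<close>

lemma haar_integral_trace_product:
  fixes \<iota> :: "nat \<Rightarrow> 'n"
  assumes inj: "inj_on \<iota> {..<m}" and mK: "m \<le> K"
  shows "(LINT U|M. (\<Prod>k<K. if k < m then trace_sym (d k) U else cnj (trace_sym (d k) U))) =
    of_nat (card (balanced_exponents m K \<iota> d))"
proof -
  interpret prob_space M
    using haar by (simp add: haar_prob_measure_def)
  let ?\<Gamma> = "multi_exponents K d :: (nat \<Rightarrow> ('n \<Rightarrow>\<^sub>0 nat)) set"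
  define P where "P \<delta> \<gamma> = (LINT U|M. entry_product m K U \<delta> \<gamma>)" for \<delta> \<gamma>
  have int: "integrable M (\<lambda>U. entry_product m K U \<delta> \<gamma>)" if "\<delta> \<in> ?\<Gamma>" "\<gamma> \<in> ?\<Gamma>" for \<delta> \<gamma>
    by (rule haar_integrable[OF continuous_on_entry_product[OF that]])
  have average: "(\<Sum>\<delta>\<in>?\<Gamma>. P \<delta> \<gamma> * multi_monomial K \<delta> T) =
      (LINT U|M. multi_monomial K \<gamma> (act m U (matrix_cnj U) T))" if "\<gamma> \<in> ?\<Gamma>" for \<gamma> T
    using that by (simp add: multi_monomial_act P_def int)
  have cont: "continuous_on UNIV (\<lambda>U. multi_monomial K \<gamma> (act m U (matrix_cnj U) T))"
    if "\<gamma> \<in> ?\<Gamma>" for \<gamma> T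
    unfolding multi_monomial_act[OF that]
    by (intro continuous_intros continuous_on_entry_product[OF _ that])
  have "(\<Sum>\<gamma>\<in>?\<Gamma>. P \<gamma> \<gamma>) = of_nat (card (balanced_exponents m K \<iota> d))"
  proof (rule trace_of_averaging[where P = P, OF inj mK])
    fix \<gamma> assume \<gamma>: "\<gamma> \<in> ?\<Gamma>"
    show "unitary_invariant m (\<lambda>T. \<Sum>\<delta>\<in>?\<Gamma>. P \<delta> \<gamma> * multi_monomial K \<delta> T)"
      unfolding unitary_invariant_def
    proof (intro ballI allI)
      fix V :: "complex^'n^'n" and T :: "nat \<Rightarrow> complex^'n"
      assume V: "V \<in> unitary_group"
      show "(\<Sum>\<delta>\<in>?\<Gamma>. P \<delta> \<gamma> * multi_monomial K \<delta> (act m V (matrix_cnj V) T)) =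
          (\<Sum>\<delta>\<in>?\<Gamma>. P \<delta> \<gamma> * multi_monomial K \<delta> T)"
        \<comment> \<open>Letting V act on \<open>T\<close> first turns U into \<open>V ** U\<close>
          in the integrand, a left translation.\<close>
        unfolding average[OF \<gamma>] using haar_translate[OF V cont[OF \<gamma>]] by (simp add: act_act matrix_cnj_mult)
    qed
  next
    fix r and T :: "nat \<Rightarrow> complex^'n"
    let ?f = "\<lambda>T. \<Sum>\<gamma>\<in>?\<Gamma>. r \<gamma> * multi_monomial K \<gamma> T"
    assume inv: "unitary_invariant m ?f"
    have "(\<Sum>\<gamma>\<in>?\<Gamma>. r \<gamma> * (\<Sum>\<delta>\<in>?\<Gamma>. P \<delta> \<gamma> * multi_monomial K \<delta> T)) =
        (\<Sum>\<gamma>\<in>?\<Gamma>. r \<gamma> * (LINT U|M. multi_monomial K \<gamma> (act m U (matrix_cnj U) T)))"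
      by (intro sum.cong refl) (simp only: average)
    also have "\<dots> = (LINT U|M. ?f (act m U (matrix_cnj U) T))"
      by (simp add: haar_integrable[OF cont])
    also have "\<dots> = (LINT U|M. ?f T)"
      using inv by (intro Bochner_Integration.integral_cong) (auto simp: haar_space unitary_invariant_def)
    also have "\<dots> = ?f T"
      by (simp add: prob_space)
    finally show "(\<Sum>\<gamma>\<in>?\<Gamma>. r \<gamma> * (\<Sum>\<delta>\<in>?\<Gamma>. P \<delta> \<gamma> * multi_monomial K \<delta> T)) = ?f T" .
  qed
  then show ?thesis
    by (simp add: P_def int flip: entry_product_trace)
qed

end

section \<open>Contingency matrices\<close>

lemma sum_upto_shift: "(\<Sum>k\<in>{m..<m + n}. f k) = (\<Sum>j<n. f (m + j))" for m n :: nat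
  by (rule sum.reindex_bij_witness[where i = "\<lambda>j. m + j" and j = "\<lambda>k. k - m"]) auto

lemma map_upt_eq_iff: "map f [0..<length xs] = xs \<longleftrightarrow> (\<forall>i<length xs. f i = xs ! i)"
  by (subst list_eq_iff_nth_eq) simp

lemma contingency_matrices_iff:
  "A \<in> contingency_matrices \<mu> \<nu> \<longleftrightarrow>
     A \<in> extensional ({..<length \<mu>} \<times> {..<length \<nu>}) \<and>
     (\<forall>i<length \<mu>. (\<Sum>j<length \<nu>. A (i, j)) = \<mu> ! i) \<and>
     (\<forall>j<length \<nu>. (\<Sum>i<length \<mu>. A (i, j)) = \<nu> ! j)"
  unfolding contingency_matrices_def nat_matrices_def row_sums_def col_sums_def map_upt_eq_iff
  by (simp add: PiE_def)

text \<open>Transposition, with a restriction that keeps the transposed matrix extensional.\<close>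

lemma contingency_number_commute: "contingency_number \<mu> \<nu> = contingency_number \<nu> \<mu>"
proof -
  define t where "t m n A = restrict (\<lambda>(j, i). A (i, j)) ({..<n} \<times> {..<m})"
    for m n and A :: "nat \<times> nat \<Rightarrow> nat"
  have maps: "t (length \<mu>) (length \<nu>) A \<in> contingency_matrices \<nu> \<mu>"
    if "A \<in> contingency_matrices \<mu> \<nu>" for A and \<mu> \<nu> :: "nat list"
    using that by (auto simp: contingency_matrices_iff t_def)
  have inverse: "t (length \<nu>) (length \<mu>) (t (length \<mu>) (length \<nu>) A) = A"
    if "A \<in> contingency_matrices \<mu> \<nu>" for A and \<mu> \<nu> :: "nat list"
    using that by (intro extensionalityI[of _ "{..<length \<mu>} \<times> {..<length \<nu>}"])
      (auto simp: contingency_matrices_iff t_def)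
  have "bij_betw (t (length \<mu>) (length \<nu>)) (contingency_matrices \<mu> \<nu>) (contingency_matrices \<nu> \<mu>)"
    by (rule bij_betw_byWitness[where f' = "t (length \<nu>) (length \<mu>)"])
      (auto simp: maps inverse)
  then show ?thesis
    unfolding contingency_number_def by (rule bij_betw_same_card)
qed

text \<open>Column j of a matrix A is stored in the exponent of vector \<open>m + j\<close>, with
  \<open>A (i, j)\<close> at coordinate \<open>\<iota> i\<close>; the exponents of the first m
  vectors are forced. The degree of vector \<open>m + j\<close> then gives the column sum, and
  balance gives the row sums.\<close>

lemma card_balanced_exponents:
  fixes \<mu> \<nu> :: "nat list" and \<iota> :: "nat \<Rightarrow> 'n::finite"
  defines "m \<equiv> length \<mu>" and "n \<equiv> length \<nu>"
  assumes inj: "inj_on \<iota> {..<m}"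
  shows "card (balanced_exponents m (m + n) \<iota> (\<lambda>k. if k < m then \<mu> ! k else \<nu> ! (k - m))) =
    contingency_number \<mu> \<nu>"
proof -
  define d where "d k = (if k < m then \<mu> ! k else \<nu> ! (k - m))" for k
  let ?B = "balanced_exponents m (m + n) \<iota> d"
  have mK: "m \<le> m + n" by simp
  note defs = balanced_exponents_def[OF inj mK] frame_exponents_def[OF inj mK]
  define \<Phi> where "\<Phi> A = restrict (\<lambda>k. if k < m then Poly_Mapping.single (\<iota> k) (\<mu> ! k)
      else (\<Sum>i<m. Poly_Mapping.single (\<iota> i) (A (i, k - m)))) {..<m + n}" for A :: "nat \<times> nat \<Rightarrow> nat"
  define \<Psi> where "\<Psi> \<delta> = restrict (\<lambda>(i, j). Poly_Mapping.lookup (\<delta> (m + j)) (\<iota> i)) ({..<m} \<times> {..<n})"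
    for \<delta> :: "nat \<Rightarrow> ('n \<Rightarrow>\<^sub>0 nat)"
  have eq_iff: "\<iota> i = \<iota> i' \<longleftrightarrow> i = i'" if "i < m" "i' < m" for i i'
    using inj that by (auto simp: inj_on_def)
  have off: "Poly_Mapping.lookup (\<Phi> A (m + j)) p = 0" if "j < n" "p \<notin> \<iota> ` {..<m}" for A j p
    using that by (auto simp: \<Phi>_def lookup_sum lookup_single when_def intro!: sum.neutral)
  have on: "Poly_Mapping.lookup (\<Phi> A (m + j)) (\<iota> i) = A (i, j)" if "i < m" "j < n" for A i j
  proof -
    have "Poly_Mapping.lookup (\<Phi> A (m + j)) (\<iota> i) = (\<Sum>i'<m. if i' = i then A (i, j) else 0)"
      using that by (auto simp: \<Phi>_def lookup_sum lookup_single when_def eq_iff intro!: sum.cong)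
    then show ?thesis using that by simp
  qed
  have total: "(\<Sum>p\<in>UNIV. Poly_Mapping.lookup (\<Phi> A (m + j)) p) = (\<Sum>i<m. A (i, j))" if "j < n" for A j
  proof -
    have "(\<Sum>p\<in>UNIV. Poly_Mapping.lookup (\<Phi> A (m + j)) p) =
        (\<Sum>p\<in>\<iota> ` {..<m}. Poly_Mapping.lookup (\<Phi> A (m + j)) p)"
      using off[OF that] by (intro sum.mono_neutral_right) auto
    then show ?thesis
      using that by (simp add: sum.reindex[OF inj] on)
  qed
  have \<Phi>: "\<Phi> A \<in> ?B" if A: "A \<in> contingency_matrices \<mu> \<nu>" for A
  proof -
    have rows: "(\<Sum>j<n. A (i, j)) = \<mu> ! i" if "i < m" for i
      using A that by (simp add: contingency_matrices_iff m_def n_def)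
    have cols: "(\<Sum>i<m. A (i, j)) = \<nu> ! j" if "j < n" for j
      using A that by (simp add: contingency_matrices_iff m_def n_def)
    have "\<Phi> A k \<in> exponents (d k)" if "k < m + n" for k
    proof (cases "k < m")
      case True
      then show ?thesis using that by (simp add: \<Phi>_def d_def exponents_single)
    next
      case False
      then obtain j where j: "k = m + j" "j < n"
        using \<open>k < m + n\<close> by (intro that[of "k - m"]) auto
      then show ?thesis
        using total[of j A] by (simp add: exponents_def d_def cols)
    qed
    moreover have "Poly_Mapping.lookup (\<Phi> A k) p = 0" if "k \<in> {m..<m + n}" "p \<notin> \<iota> ` {..<m}" for k p
    proof -
      have "k - m < n" "m + (k - m) = k" using that by auto
      then show ?thesis using off[of "k - m" p A] that by simp
    qed
    moreover have "(\<Sum>k\<in>{m..<m + n}. Poly_Mapping.lookup (\<Phi> A k) (\<iota> i)) = d i" if "i < m" for i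
      using that by (simp add: sum_upto_shift on d_def rows)
    ultimately show ?thesis
      by (auto simp: defs multi_exponents_def PiE_iff) (auto simp: \<Phi>_def d_def)
  qed
  have \<Psi>: "\<Psi> \<delta> \<in> contingency_matrices \<mu> \<nu>" if \<delta>: "\<delta> \<in> ?B" for \<delta>
  proof -
    have "(\<Sum>j<n. \<Psi> \<delta> (i, j)) = \<mu> ! i" if "i < m" for i
    proof -
      have "(\<Sum>k\<in>{m..<m + n}. Poly_Mapping.lookup (\<delta> k) (\<iota> i)) = d i"
        using \<delta> that by (simp add: defs)
      then show ?thesis
        using that by (simp add: sum_upto_shift \<Psi>_def d_def)
    qed
    moreover have "(\<Sum>i<m. \<Psi> \<delta> (i, j)) = \<nu> ! j" if "j < n" for j
    proof -
      have "\<delta> \<in> frame_exponents m (m + n) \<iota> d"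
        using \<delta> by (simp add: balanced_exponents_def[OF inj mK])
      then have "(\<Sum>i<m. Poly_Mapping.lookup (\<delta> (m + j)) (\<iota> i)) = d (m + j)"
        using that by (intro frame_exponents_sum[OF inj mK]) auto
      then show ?thesis
        using that by (simp add: \<Psi>_def d_def)
    qed
    moreover have "\<Psi> \<delta> \<in> extensional ({..<m} \<times> {..<n})"
      by (simp add: \<Psi>_def)
    ultimately show ?thesis
      by (simp add: contingency_matrices_iff m_def n_def)
  qed
  have "bij_betw \<Phi> (contingency_matrices \<mu> \<nu>) ?B"
  proof (rule bij_betw_byWitness[where f' = \<Psi>])
    show "\<forall>A\<in>contingency_matrices \<mu> \<nu>. \<Psi> (\<Phi> A) = A"
    proof
      fix A assume "A \<in> contingency_matrices \<mu> \<nu>"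
      then have "A \<in> extensional ({..<m} \<times> {..<n})"
        by (simp add: contingency_matrices_iff m_def n_def)
      then show "\<Psi> (\<Phi> A) = A"
        by (intro extensionalityI[of _ "{..<m} \<times> {..<n}"]) (auto simp: \<Psi>_def on)
    qed
    show "\<forall>\<delta>\<in>?B. \<Phi> (\<Psi> \<delta>) = \<delta>"
    proof
      fix \<delta> assume \<delta>: "\<delta> \<in> ?B"
      show "\<Phi> (\<Psi> \<delta>) = \<delta>"
      proof (rule extensionalityI[of _ "{..<m + n}"])
        show "\<Phi> (\<Psi> \<delta>) \<in> extensional {..<m + n}"
          by (simp add: \<Phi>_def)
        show "\<delta> \<in> extensional {..<m + n}"
          using \<delta> by (simp add: defs multi_exponents_def PiE_iff)
        fix k assume k: "k \<in> {..<m + n}"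
        show "\<Phi> (\<Psi> \<delta>) k = \<delta> k"
        proof (cases "k < m")
          case True
          then show ?thesis
            using \<delta> k by (simp add: \<Phi>_def defs d_def)
        next
          case False
          then obtain j where j: "k = m + j" "j < n"
            using k by (intro that[of "k - m"]) auto
          show ?thesis
          proof (rule poly_mapping_eqI)
            fix p
            show "Poly_Mapping.lookup (\<Phi> (\<Psi> \<delta>) k) p = Poly_Mapping.lookup (\<delta> k) p"
            proof (cases "p \<in> \<iota> ` {..<m}")
              case True
              then show ?thesis using j by (auto simp: on \<Psi>_def)
            next
              case False
              then show ?thesis using \<delta> j off[of j p "\<Psi> \<delta>"] by (simp add: defs)
            qed
          qed
        qed
      qed
    qed
  qed (use \<Phi> \<Psi> in auto)
  then have "card ?B = contingency_number \<mu> \<nu>"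
    unfolding contingency_number_def by (rule bij_betw_same_card[symmetric])
  then show ?thesis
    by (simp add: d_def[abs_def])
qed

section \<open>From multiplicities to products over the parts of a partition\<close>

lemma prod_nth_count_list:
  fixes f :: "'a \<Rightarrow> 'b::comm_monoid_mult"
  assumes "finite X" "set xs \<subseteq> X"
  shows "(\<Prod>i<length xs. f (xs ! i)) = (\<Prod>x\<in>X. f x ^ count_list xs x)"
  using assms(2)
proof (induction xs)
  case (Cons y xs)
  have "(\<Prod>x\<in>X. f x ^ count_list (y # xs) x) =
      (\<Prod>x\<in>X. (if x = y then f y else 1) * f x ^ count_list xs x)"
    by (intro prod.cong) auto
  then show ?case
    using Cons assms(1) by (simp add: prod.distrib prod.lessThan_Suc_shift del: prod.lessThan_Suc)
qed simp

lemma partition_length: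
  assumes "partition_with_multiplicities l a \<mu>"
  shows "length \<mu> = (\<Sum>j=1..l. a j)"
  using assms sum_count_set[of \<mu> "{1..l}"] by (simp add: partition_with_multiplicities_def)

lemma partition_prod:
  fixes f :: "nat \<Rightarrow> 'a::comm_monoid_mult"
  assumes "partition_with_multiplicities l a \<mu>"
  shows "(\<Prod>i<length \<mu>. f (\<mu> ! i)) = (\<Prod>j=1..l. f j ^ a j)"
  using assms prod_nth_count_list[of "{1..l}" \<mu> f] by (simp add: partition_with_multiplicities_def)

text \<open>Indices below m carry the parts of \<open>\<mu>\<close> and the action of U, the others
  the parts of \<open>\<nu>\<close> and the conjugate action. The number of parts of
  \<open>\<mu>\<close> is the sum of the \<open>a j\<close>, so the bound supplies the injection
  \<open>\<iota>\<close>.\<close>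

lemma haar_integral_short_partition:
  fixes M :: "(complex^'n^'n) measure"
  assumes haar: "haar_prob_measure M"
    and \<mu>: "partition_with_multiplicities l a \<mu>" and \<nu>: "partition_with_multiplicities l b \<nu>"
    and short: "(\<Sum>j=1..l. a j) \<le> CARD('n)"
  shows "(LINT U|M. (\<Prod>j=1..l. trace_sym j U ^ a j * cnj (trace_sym j U ^ b j))) =
    of_nat (contingency_number \<mu> \<nu>)"
proof -
  let ?m = "length \<mu>" and ?n = "length \<nu>"
  define d where "d k = (if k < ?m then \<mu> ! k else \<nu> ! (k - ?m))" for k
  have "card {..<?m} \<le> card (UNIV :: 'n set)"
    using short partition_length[OF \<mu>] by simp
  then obtain \<iota> :: "nat \<Rightarrow> 'n" where inj: "inj_on \<iota> {..<?m}"
    using card_le_inj[of "{..<?m}" "UNIV :: 'n set"] by auto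
  have "(\<Prod>k<?m + ?n. if k < ?m then trace_sym (d k) U else cnj (trace_sym (d k) U)) =
      (\<Prod>j=1..l. trace_sym j U ^ a j * cnj (trace_sym j U ^ b j))" for U :: "complex^'n^'n"
  proof -
    let ?t = "\<lambda>k. if k < ?m then trace_sym (d k) U else cnj (trace_sym (d k) U)"
    have "{..<?m + ?n} = {..<?m} \<union> {?m..<?m + ?n}" by auto
    then have "(\<Prod>k<?m + ?n. ?t k) = (\<Prod>k<?m. ?t k) * (\<Prod>k\<in>{?m..<?m + ?n}. ?t k)"
      by (simp add: prod.union_disjoint ivl_disj_int)
    also have "(\<Prod>k\<in>{?m..<?m + ?n}. ?t k) = (\<Prod>j<?n. cnj (trace_sym (\<nu> ! j) U))"
      by (rule prod.reindex_bij_witness[where i = "\<lambda>j. ?m + j" and j = "\<lambda>k. k - ?m"])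
        (auto simp: d_def)
    also have "(\<Prod>k<?m. ?t k) = (\<Prod>i<?m. trace_sym (\<mu> ! i) U)"
      by (intro prod.cong) (auto simp: d_def)
    finally show ?thesis
      by (simp add: partition_prod[OF \<mu>, of "\<lambda>j. trace_sym j U"]
          partition_prod[OF \<nu>, of "\<lambda>j. cnj (trace_sym j U)"] prod.distrib)
  qed
  then show ?thesis
    using haar_integral_trace_product[OF haar inj, of "?m + ?n" d] card_balanced_exponents[OF inj, of \<nu>]
    by (simp add: d_def[abs_def])
qed

theorem lemma3p1:
  fixes M :: "(complex^'n^'n) measure"
    and l :: nat
    and a b :: "nat \<Rightarrow> nat"
    and \<mu> \<mu>' :: "nat list"
  assumes "haar_prob_measure M"
    and "partition_with_multiplicities l a \<mu>"
    and "partition_with_multiplicities l b \<mu>'"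
    and "min (\<Sum>j=1..l. a j) (\<Sum>j=1..l. b j) \<le> CARD('n)"
  shows "(LINT U|M. (\<Prod>j=1..l. trace_sym j U ^ a j * cnj (trace_sym j U ^ b j))) =
           of_nat (contingency_number \<mu> \<mu>')"
proof (cases "(\<Sum>j=1..l. a j) \<le> CARD('n)")
  case True
  then show ?thesis by (rule haar_integral_short_partition[OF assms(1-3)])
next
  case False
  then have "(\<Sum>j=1..l. b j) \<le> CARD('n)"
    using assms(4) by (simp add: min_def split: if_splits)
  then have eq: "(LINT U|M. (\<Prod>j=1..l. trace_sym j U ^ b j * cnj (trace_sym j U ^ a j))) =
      of_nat (contingency_number \<mu>' \<mu>)"
    by (rule haar_integral_short_partition[OF assms(1,3,2)])
  have "(\<Prod>j=1..l. trace_sym j U ^ a j * cnj (trace_sym j U ^ b j)) =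
      cnj (\<Prod>j=1..l. trace_sym j U ^ b j * cnj (trace_sym j U ^ a j))" for U :: "complex^'n^'n"
    by (simp add: mult.commute)
  then have "(LINT U|M. (\<Prod>j=1..l. trace_sym j U ^ a j * cnj (trace_sym j U ^ b j))) =
      cnj (LINT U|M. (\<Prod>j=1..l. trace_sym j U ^ b j * cnj (trace_sym j U ^ a j)))"
    by (simp only: Bochner_Integration.integral_cnj)
  \<comment> \<open>The value is a natural number, so conjugation leaves it unchanged.\<close>
  also have "\<dots> = of_nat (contingency_number \<mu>' \<mu>)"
    unfolding eq by simp
  finally show ?thesis
    by (simp only: contingency_number_commute[of \<mu>' \<mu>])
qed

end
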